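(* Let $U = a e_r + b e_\theta + c e_z$ be an axisymmetric solution of the Euler equation on the solid torus $M$ with pressure $P$, with initial velocity $U_0 = a_0e_r+b_0e_\theta+c_0e_z$. Suppose $c_0$ is odd in $z$, and that $a_0$ and $b_0$ are both even in $z$. Then the origin $\mathbf{0}$ ($r=0$, $z=0$) is a fixed point of the flow $\eta$ of $U$. Assume moreover that the solution ceases to exist at time $t=T<\infty$ due to pointwise blowup of vorticity at the origin; that is, assume $$\int_0^T |\omega(t,\mathbf{0})|\,dt = \infty .$$ Then the pressure function must satisfy $$\limsup_{t\to T}\,(T-t)^2 P_{rr}(t,\mathbf{0}) \ge \tfrac14 .$$
   Context: Configuration domain: $M=\{(x,y,z): x^2+y^2\le 1,\ -\pi\le z\le \pi\}/\{(x,y,-\pi)\equiv(x,y,\pi)\}$ with the flat metric and cylindrical coordinates $(r,\theta,z)$; $e_r,e_\theta,e_z$ are the usual cylindrical unit vector fields. An axisymmetric velocity field is $U=ae_r+be_\theta+ce_z$ with $a,b,c$ functions of $(t,r,z)$ only; $U$ is tangent to $\partial M$ (i.e. $a=0$ at $r=1$). The Euler equation is $U_t+U\cdot\nabla U=-\nabla P$, $\operatorname{div}U=0$, $U|_{t=0}=U_0$, where the axisymmetric pressure $P=P(t,r,z)$ is determined (up to a function of time) by $\Delta P=-\operatorname{Tr}((\nabla U)^2)$ with $\langle\nabla P,e_r\rangle=-\langle U\cdot\nabla U,e_r\rangle$ at $r=1$. Solutions are assumed smooth on $[0,T)$. The vorticity is $\omega=\operatorname{curl}U$. The flow $\eta:[0,T)\times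 M\to M$ is defined by $\eta_t(t,x)=U(t,\eta(t,x))$, $\eta(0,x)=x$. Odd/even in $z$ refers to the reflection $z\mapsto -z$ of $z\in[-\pi,\pi]$. Subscripts $r,z,t$ denote partial derivatives, and $P_{rr}(t,\mathbf 0)$ means $P_{rr}(t,r,z)$ at $r=0,z=0$. *)

theory Defs
  imports "HOL-Analysis.Analysis"
begin

text \<open>
  The solid torus \<open>M\<close> is the quotient of the solid cylinder below by the translation
  \<open>z \<mapsto> z + 2\<pi>\<close>. Functions on \<open>M\<close> are represented by their \<open>2\<pi>\<close>-periodic lifts to the
  cylinder, and all spatial derivatives are Cartesian, taken within the closed cylinder
  (one-sided at the boundary \<open>r = 1\<close>).
\<close>

definition cylinder :: "(real^3) set" where
  "cylinder = {x. (x $ 1)\<^sup>2 + (x $ 2)\<^sup>2 \<le> 1}"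

definition z_periodic :: "(real^3 \<Rightarrow> 'b) \<Rightarrow> bool" where
  "z_periodic f \<longleftrightarrow> (\<forall>x\<in>cylinder. f (x + axis 3 (2 * pi)) = f x)"

definition cyl :: "real \<Rightarrow> real \<Rightarrow> real \<Rightarrow> real^3" where
  "cyl r \<theta> z = vector [r * cos \<theta>, r * sin \<theta>, z]"

definition e_r :: "real \<Rightarrow> real^3" where
  "e_r \<theta> = vector [cos \<theta>, sin \<theta>, 0]"

definition e_theta :: "real \<Rightarrow> real^3" where
  "e_theta \<theta> = vector [- sin \<theta>, cos \<theta>, 0]"

definition e_z :: "real^3" where
  "e_z = vector [0, 0, 1]"

text \<open>
  \<open>V = a e\<^sub>r + b e\<^sub>\<theta> + c e\<^sub>z\<close> with profiles depending on \<open>(r, z)\<close> only. At \<open>r = 0\<close> the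
  identity is required for every \<open>\<theta>\<close>, which forces \<open>a = b = 0\<close> on the axis; for a
  continuous field this is automatic if \<open>a(0,z)\<close>, \<open>b(0,z)\<close> are the limits as \<open>r \<rightarrow> 0\<close>.
\<close>

definition axisymmetric_field ::
  "(real \<Rightarrow> real \<Rightarrow> real) \<Rightarrow> (real \<Rightarrow> real \<Rightarrow> real) \<Rightarrow> (real \<Rightarrow> real \<Rightarrow> real) \<Rightarrow> (real^3 \<Rightarrow> real^3) \<Rightarrow> bool"
where
  "axisymmetric_field a b c V \<longleftrightarrow>
     (\<forall>r\<in>{0..1}. \<forall>\<theta> z. V (cyl r \<theta> z) = a r z *\<^sub>R e_r \<theta> + b r z *\<^sub>R e_theta \<theta> + c r z *\<^sub>R e_z)"

definition axisymmetric_scalar :: "(real \<Rightarrow> real \<Rightarrow> real) \<Rightarrow> (real^3 \<Rightarrow> real) \<Rightarrow> bool" where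
  "axisymmetric_scalar p f \<longleftrightarrow> (\<forall>r\<in>{0..1}. \<forall>\<theta> z. f (cyl r \<theta> z) = p r z)"

text \<open>
  \<open>C\<^sup>k\<close> and smooth functions on a set \<open>S\<close>, up to and including those boundary points which
  belong to \<open>S\<close>. It is applied only to convex \<open>S\<close> with nonempty interior, where the
  derivative within \<open>S\<close> is unique.
\<close>

primrec Ck_on :: "nat \<Rightarrow> ('a::euclidean_space \<Rightarrow> 'b::real_normed_vector) \<Rightarrow> 'a set \<Rightarrow> bool" where
  "Ck_on 0 f S = continuous_on S f"
| "Ck_on (Suc k) f S =
     (\<exists>f'. (\<forall>x\<in>S. (f has_derivative f' x) (at x within S)) \<and> (\<forall>v\<in>Basis. Ck_on k (\<lambda>x. f' x v) S))"

definition smooth_on :: "('a::euclidean_space \<Rightarrow> 'b::real_normed_vector) \<Rightarrow> 'a set \<Rightarrow> bool" where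
  "smooth_on f S \<longleftrightarrow> (\<forall>k. Ck_on k f S)"

text \<open>Entry \<open>(i, j)\<close> of \<open>jac V x\<close> is \<open>\<partial>\<^sub>j V\<^sub>i\<close>.\<close>

definition jac :: "(real^3 \<Rightarrow> real^3) \<Rightarrow> real^3 \<Rightarrow> real^3^3" where
  "jac V x = jacobian V (at x within cylinder)"

definition grad :: "(real^3 \<Rightarrow> real) \<Rightarrow> real^3 \<Rightarrow> real^3" where
  "grad f x = (\<chi> i. frechet_derivative f (at x within cylinder) (axis i 1))"

definition divergence :: "(real^3 \<Rightarrow> real^3) \<Rightarrow> real^3 \<Rightarrow> real" where
  "divergence V x = trace (jac V x)"

definition laplacian :: "(real^3 \<Rightarrow> real) \<Rightarrow> real^3 \<Rightarrow> real" where
  "laplacian f x = divergence (grad f) x"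

definition curl :: "(real^3 \<Rightarrow> real^3) \<Rightarrow> real^3 \<Rightarrow> real^3" where
  "curl V x = (let D = jac V x in
     vector [D $ 3 $ 2 - D $ 2 $ 3, D $ 1 $ 3 - D $ 3 $ 1, D $ 2 $ 1 - D $ 1 $ 2])"

definition advect :: "(real^3 \<Rightarrow> real^3) \<Rightarrow> (real^3 \<Rightarrow> real^3) \<Rightarrow> real^3 \<Rightarrow> real^3" where
  "advect V W x = jac W x *v V x"

text \<open>
  A smooth axisymmetric solution on \<open>[0, T)\<close>. Since the pressure is determined only up to a
  function of time, \<open>P t\<close> is required to be smooth in space only. The Poisson equation and
  the Neumann condition for \<open>P\<close> are consequences of the other clauses; they are listed
  because they are the equations by which the pressure is determined.
\<close>

definition axisymmetric_euler_solution ::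
  "real \<Rightarrow> (real \<Rightarrow> real \<Rightarrow> real \<Rightarrow> real) \<Rightarrow> (real \<Rightarrow> real \<Rightarrow> real \<Rightarrow> real) \<Rightarrow> (real \<Rightarrow> real \<Rightarrow> real \<Rightarrow> real) \<Rightarrow>
   (real \<Rightarrow> real \<Rightarrow> real \<Rightarrow> real) \<Rightarrow> (real \<Rightarrow> real^3 \<Rightarrow> real^3) \<Rightarrow> (real \<Rightarrow> real^3 \<Rightarrow> real) \<Rightarrow>
   (real^3 \<Rightarrow> real^3) \<Rightarrow> bool"
where
  "axisymmetric_euler_solution T a b c p U P U\<^sub>0 \<longleftrightarrow>
     smooth_on (\<lambda>(t, x). U t x) ({0..<T} \<times> cylinder) \<and>
     (\<forall>t\<in>{0..<T}.
        z_periodic (U t) \<and> axisymmetric_field (a t) (b t) (c t) (U t) \<and>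
        smooth_on (P t) cylinder \<and> z_periodic (P t) \<and> axisymmetric_scalar (p t) (P t) \<and>
        (\<forall>z. a t 1 z = 0) \<and>
        (\<forall>x\<in>cylinder.
           vector_derivative (\<lambda>s. U s x) (at t within {0..<T}) + advect (U t) (U t) x
             = - grad (P t) x \<and>
           divergence (U t) x = 0 \<and>
           laplacian (P t) x = - trace (jac (U t) x ** jac (U t) x)) \<and>
        (\<forall>\<theta> z. grad (P t) (cyl 1 \<theta> z) \<bullet> e_r \<theta> = - (advect (U t) (U t) (cyl 1 \<theta> z) \<bullet> e_r \<theta>))) \<and>
     (\<forall>x\<in>cylinder. U 0 x = U\<^sub>0 x)"

text \<open>The flow on \<open>M\<close>, represented by its lift to the cylinder starting at the identity.\<close>

definition is_flow :: "real \<Rightarrow> (real \<Rightarrow> real^3 \<Rightarrow> real^3) \<Rightarrow> (real \<Rightarrow> real^3 \<Rightarrow> real^3) \<Rightarrow> bool" where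
  "is_flow T U \<eta> \<longleftrightarrow>
     (\<forall>x\<in>cylinder. \<eta> 0 x = x \<and>
        (\<forall>t\<in>{0..<T}. \<eta> t x \<in> cylinder \<and>
           ((\<lambda>s. \<eta> s x) has_vector_derivative U t (\<eta> t x)) (at t within {0..<T})))"

text \<open>Parity in \<open>z\<close> of a function of \<open>(r, z)\<close> with \<open>0 \<le> r \<le> 1\<close>, \<open>-\<pi> \<le> z \<le> \<pi>\<close>.\<close>

definition even_in_z :: "(real \<Rightarrow> real \<Rightarrow> real) \<Rightarrow> bool" where
  "even_in_z f \<longleftrightarrow> (\<forall>r\<in>{0..1}. \<forall>z\<in>{-pi..pi}. f r (- z) = f r z)"

definition odd_in_z :: "(real \<Rightarrow> real \<Rightarrow> real) \<Rightarrow> bool" where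
  "odd_in_z f \<longleftrightarrow> (\<forall>r\<in>{0..1}. \<forall>z\<in>{-pi..pi}. f r (- z) = - f r z)"

text \<open>The second derivative \<open>f\<^sub>r\<^sub>r(r, z)\<close> for \<open>0 \<le> r \<le> 1\<close>, one-sided at the endpoints.\<close>

definition d_rr :: "(real \<Rightarrow> real \<Rightarrow> real) \<Rightarrow> real \<Rightarrow> real \<Rightarrow> real" where
  "d_rr f r z = vector_derivative
     (\<lambda>s. vector_derivative (\<lambda>\<rho>. f \<rho> z) (at s within {0..1})) (at r within {0..1})"

end

theory Submission
  imports Defs
begin

text \<open>
  The reflection \<open>z \<mapsto> - z\<close> maps the solution to another axisymmetric solution with the same
  initial velocity. An energy estimate shows that the two coincide; in the meridian half-plane,
  with weight \<open>r\<close>, it needs only the fundamental theorem of calculus. Hence \<open>U\<close> vanishes at the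
  origin.

  There \<open>\<nabla>U\<close> is determined by \<open>\<alpha> = a\<^sub>r\<close> and \<open>\<beta> = b\<^sub>r\<close>, the vorticity has length
  \<open>2 \<bar>\<beta>\<bar>\<close>, and differentiating the Euler equation along a radius gives
  \<open>\<alpha>' = \<beta>\<^sup>2 - \<alpha>\<^sup>2 - P\<^sub>r\<^sub>r\<close> and \<open>\<beta>' = - 2 \<alpha> \<beta>\<close>. Consequently
  \<open>exp (\<integral>\<alpha>) * exp (\<i> \<integral>\<beta>)\<close> solves \<open>y'' = - P\<^sub>r\<^sub>r y\<close>. If the vorticity integral diverges, the
  argument winds around infinitely often and the imaginary part oscillates; but by Sturm
  comparison with \<open>y'' = - y / (4 (T - t)\<^sup>2)\<close>, which is nonoscillatory, this is impossible when
  eventually \<open>(T - t)\<^sup>2 P\<^sub>r\<^sub>r < 1/4\<close>.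
\<close>

section \<open>Ordinary differential inequalities on the axis\<close>

text \<open>Parity is assumed of the initial velocity alone, so its persistence has to be proved;
  this is the sole purpose of the energy uniqueness. The pressure is smooth only in space at each
  fixed time, so no time derivative may fall on it. In the half-plane the azimuthal derivative
  carries the coefficient 1/r. Multiplication by r, which is also the Jacobian of cylindrical
  coordinates, removes this singularity; what it loses on the axis is recovered by continuity.

  The constant 1/4 is the threshold of Euler's equation y'' + k y / (T - t)^2 = 0: a power (T - t)^m
  solves it when m (m - 1) + k = 0, and m is real exactly for k \<le> 1/4. At k = 1/4 the double
  root m = 1/2 gives the square root used for comparison.

  The bound on the limsup is proved by contraposition. It is enough to exclude a single half turn:
  \<beta> keeps its sign, so the argument is monotone and its total growth is the integral of the
  absolute value of \<beta>.\<close>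

lemma nondecreasing_if_derivative_within:
  fixes f :: "real \<Rightarrow> real"
  assumes "a \<le> b"
    and der: "\<And>x. x \<in> {a..b} \<Longrightarrow> (f has_real_derivative f' x) (at x within {a..b})"
    and nonneg: "\<And>x. x \<in> {a..b} \<Longrightarrow> 0 \<le> f' x"
  shows "f a \<le> f b"
proof (rule DERIV_nonneg_imp_increasing_open[OF \<open>a \<le> b\<close>])
  show "continuous_on {a..b} f"
    using der by (rule DERIV_continuous_on)
  fix x assume "a < x" "x < b"
  then show "\<exists>y. (f has_real_derivative y) (at x) \<and> 0 \<le> y"
    using der[of x] nonneg[of x] at_within_Icc_at[of a x b] by auto
qed

text \<open>The integrating factor makes \<open>exp (- K * s) * h s\<close> nonincreasing. It serves
  twice: for the energy of the difference of two flows and for the squared distance of a trajectory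
  from the origin.\<close>

lemma gronwall_nonpos:
  fixes h :: "real \<Rightarrow> real"
  assumes der: "\<And>t. t \<in> {0..\<tau>} \<Longrightarrow> (h has_real_derivative h' t) (at t within {0..\<tau>})"
    and bound: "\<And>t. t \<in> {0..\<tau>} \<Longrightarrow> h' t \<le> K * h t"
    and "h 0 \<le> 0" and t: "t \<in> {0..\<tau>}"
  shows "h t \<le> 0"
proof -
  have "- (exp (- K * 0) * h 0) \<le> - (exp (- K * t) * h t)"
  proof (rule nondecreasing_if_derivative_within[where f = "\<lambda>s. - (exp (- K * s) * h s)"])
    fix s assume s: "s \<in> {0..t}"
    have "(h has_real_derivative h' s) (at s within {0..t})"
      using DERIV_subset[OF der, of s "{0..t}"] s t by auto
    then show "((\<lambda>s. - (exp (- K * s) * h s)) has_real_derivative exp (- K * s) * (K * h s - h' s))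
      (at s within {0..t})"
      by (auto intro!: derivative_eq_intros simp: algebra_simps)
    show "0 \<le> exp (- K * s) * (K * h s - h' s)"
      using bound[of s] s t by simp
  qed (use t in simp)
  then show ?thesis
    using \<open>h 0 \<le> 0\<close> by (simp add: mult_le_0_iff) (smt (verit) exp_gt_zero mult_pos_pos)
qed

text \<open>The fundamental theorem of calculus applies on closed subintervals, and monotone
  convergence carries the bound to the half-open interval. Boundedness of the growth of
  \<open>F\<close> replaces a limit at \<open>b\<close>, where \<open>f\<close> may blow up.\<close>

lemma nn_integral_Ico_le:
  fixes F f :: "real \<Rightarrow> real"
  assumes ab: "a < b"
    and der: "\<And>t. t \<in> {a..<b} \<Longrightarrow> (F has_real_derivative f t) (at t within {a..<b})"
    and cont: "continuous_on {a..<b} f"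
    and nonneg: "\<And>t. t \<in> {a..<b} \<Longrightarrow> 0 \<le> f t"
    and bound: "\<And>t. t \<in> {a..<b} \<Longrightarrow> F t - F a \<le> B"
  shows "(\<integral>\<^sup>+ t\<in>{a..<b}. ennreal (f t) \<partial>lborel) \<le> ennreal B"
proof -
  \<comment> \<open>The sequence starts at \<open>a\<close> and increases to \<open>b\<close>
    without reaching it, so \<open>f\<close> is continuous on every \<open>{a..s n}\<close>.\<close>
  define s where "s n = b - (b - a) / real (Suc n)" for n
  have s: "a \<le> s n" "s n < b" for n
    using ab mult_right_mono[of a b "real n"] by (simp_all add: s_def field_simps)
  have "incseq s"
    using ab by (auto simp: s_def incseq_def intro!: divide_left_mono)
  have s_lim: "s \<longlonglongrightarrow> b"
    unfolding s_def
    using tendsto_diff[OF tendsto_const LIMSEQ_Suc[OF lim_const_over_n[of "b - a"]], of b] by simp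
  have Un: "(\<Union>n. {a..s n}) = {a..<b}"
  proof (intro set_eqI iffI)
    fix x assume "x \<in> {a..<b}"
    then have "eventually (\<lambda>n. x < s n) sequentially"
      using order_tendstoD(1)[OF s_lim, of x] by auto
    then obtain n where "x < s n"
      by (auto simp: eventually_sequentially)
    then show "x \<in> (\<Union>n. {a..s n})"
      using \<open>x \<in> {a..<b}\<close> by (auto intro!: exI[of _ n])
  next
    fix x assume "x \<in> (\<Union>n. {a..s n})"
    then obtain n where "a \<le> x" "x \<le> s n" by auto
    then show "x \<in> {a..<b}"
      using s(2)[of n] by simp
  qed
  have sub: "{a..s n} \<subseteq> {a..<b}" for n
    using s[of n] by auto
  have meas: "(\<lambda>t. indicator {a..s n} t * f t) \<in> borel_measurable borel" for n
    using borel_measurable_continuous_on_indicator[OF _ continuous_on_subset[OF cont sub]] by simp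
  have restr: "ennreal (f t) * indicator {a..s n} t = ennreal (indicator {a..s n} t * f t)" for n t
    by (auto simp: indicator_def)
  have "(\<integral>\<^sup>+ t\<in>{a..<b}. ennreal (f t) \<partial>lborel)
      = (\<integral>\<^sup>+ t. (SUP n. ennreal (f t) * indicator {a..s n} t) \<partial>lborel)"
  proof (rule nn_integral_cong)
    fix t
    show "ennreal (f t) * indicator {a..<b} t = (SUP n. ennreal (f t) * indicator {a..s n} t)"
    proof (cases "t \<in> {a..<b}")
      case True
      then obtain n where "t \<in> {a..s n}"
        using Un by blast
      then show ?thesis
        using True by (intro antisym SUP_upper2[of n] SUP_least) (auto simp: indicator_def)
    next
      case False
      then have "t \<notin> {a..s n}" for n
        using sub by blast
      then show ?thesis
        using False by simp
    qed
  qed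
  also have "\<dots> = (SUP n. \<integral>\<^sup>+ t. ennreal (f t) * indicator {a..s n} t \<partial>lborel)"
  proof (rule nn_integral_monotone_convergence_SUP)
    show "incseq (\<lambda>n t. ennreal (f t) * indicator {a..s n} t)"
      using order_trans[OF _ incseqD[OF \<open>incseq s\<close>]]
      by (auto simp: incseq_def le_fun_def indicator_def)
  qed (use meas restr in simp)
  also have "\<dots> \<le> ennreal B"
  proof (rule SUP_least)
    fix n
    have "(f has_integral F (s n) - F a) {a..s n}"
      using s[of n] sub[of n]
      by (intro fundamental_theorem_of_calculus)
        (auto simp flip: has_real_derivative_iff_has_vector_derivative intro: DERIV_subset[OF der])
    then have "((\<lambda>t. if t \<in> {a..s n} then f t else 0) has_integral F (s n) - F a) UNIV"
      by (simp only: has_integral_restrict_UNIV)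
    then have "((\<lambda>t. indicator {a..s n} t * f t) has_integral F (s n) - F a) UNIV"
      by (rule has_integral_eq[rotated]) auto
    moreover have "0 \<le> indicator {a..s n} t * f t" for t
      using nonneg[of t] sub[of n] by (auto simp: indicator_def)
    ultimately have "(\<integral>\<^sup>+ t. ennreal (indicator {a..s n} t * f t) \<partial>lborel) = ennreal (F (s n) - F a)"
      by (intro nn_integral_has_integral_lborel meas)
    then show "(\<integral>\<^sup>+ t. ennreal (f t) * indicator {a..s n} t \<partial>lborel) \<le> ennreal B"
      using bound[of "s n"] s[of n] by (simp add: restr ennreal_leI)
  qed
  finally show ?thesis .
qed

section \<open>A complex Riccati equation and Sturm comparison\<close>

locale axis_ode =
  fixes t\<^sub>0 T :: real and \<alpha> \<beta> q :: "real \<Rightarrow> real"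
  assumes t0_less: "t\<^sub>0 < T"
    and alpha_deriv: "\<And>t. t \<in> {t\<^sub>0..<T} \<Longrightarrow>
      (\<alpha> has_real_derivative (\<beta> t)\<^sup>2 - (\<alpha> t)\<^sup>2 - q t) (at t within {t\<^sub>0..<T})"
    and beta_deriv: "\<And>t. t \<in> {t\<^sub>0..<T} \<Longrightarrow>
      (\<beta> has_real_derivative - 2 * \<alpha> t * \<beta> t) (at t within {t\<^sub>0..<T})"
    and q_less: "\<And>t. t \<in> {t\<^sub>0..<T} \<Longrightarrow> (T - t)\<^sup>2 * q t < 1 / 4"
begin

text \<open>The two equations say that \<lambda> = \<alpha> + i \<beta> satisfies \<lambda>' = -
  \<lambda>^2 - q. The substitution y'/y = \<lambda> linearises this to y'' = - q y;
  \<open>A\<close> is the logarithm of the modulus of y, and \<open>\<theta>\<close> is its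
  argument.\<close>

definition A where "A t = integral {t\<^sub>0..t} \<alpha>"
definition \<theta> where "\<theta> t = integral {t\<^sub>0..t} \<beta>"

lemma continuous_coeffs: "continuous_on {t\<^sub>0..<T} \<alpha>" "continuous_on {t\<^sub>0..<T} \<beta>"
  by (rule DERIV_continuous_on, erule alpha_deriv beta_deriv)+

lemma primitive_deriv:
  assumes "continuous_on {t\<^sub>0..<T} f" "t \<in> {t\<^sub>0..<T}"
  shows "((\<lambda>t. integral {t\<^sub>0..t} f) has_real_derivative f t) (at t within {t\<^sub>0..<T})"
proof -
  \<comment> \<open>A point strictly between \<open>t\<close> and \<open>T\<close>: near
    \<open>t\<close> the compact interval \<open>{t\<^sub>0..u}\<close> and
    \<open>{t\<^sub>0..<T}\<close> coincide, so the derivatives within them agree.\<close>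
  define u where "u = (t + T) / 2"
  have u: "t < u" "u < T" "t \<in> {t\<^sub>0..u}"
    using assms(2) by (auto simp: u_def)
  have "((\<lambda>t. integral {t\<^sub>0..t} f) has_real_derivative f t) (at t within {t\<^sub>0..u})"
    using u by (intro integral_has_real_derivative continuous_on_subset[OF assms(1)]) auto
  moreover have "at t within {t\<^sub>0..u} = at t within {t\<^sub>0..<T}"
    using u by (intro at_within_nhd[where S = "{..<u}"]) auto
  ultimately show ?thesis by simp
qed

lemmas A_deriv = primitive_deriv[OF continuous_coeffs(1), folded A_def]
lemmas theta_deriv = primitive_deriv[OF continuous_coeffs(2), folded \<theta>_def]

text \<open>The product \<open>\<beta> t * exp (2 * A t)\<close> is the constant Wronskian of the
  two solutions exp A cos \<theta> and exp A sin \<theta>. Hence \<beta> either vanishes identically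
  or keeps its sign.\<close>

lemma beta_eq:
  assumes t: "t \<in> {t\<^sub>0..<T}"
  shows "\<beta> t = \<beta> t\<^sub>0 * exp (- 2 * A t)"
proof -
  have "((\<lambda>t. \<beta> t * exp (2 * A t)) has_real_derivative 0) (at s within {t\<^sub>0..<T})"
    if "s \<in> {t\<^sub>0..<T}" for s
    using beta_deriv[OF that] A_deriv[OF that]
    by (auto intro!: derivative_eq_intros)
  then obtain C where "\<beta> s * exp (2 * A s) = C" if "s \<in> {t\<^sub>0..<T}" for s
    using has_field_derivative_zero_constant[of "{t\<^sub>0..<T}" "\<lambda>t. \<beta> t * exp (2 * A t)"] by auto
  then have "\<beta> t * exp (2 * A t) = \<beta> t\<^sub>0 * exp (2 * A t\<^sub>0)"
    using t0_less t by simp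
  then show ?thesis
    by (simp add: A_def exp_minus field_simps)
qed

text \<open>
  With \<open>\<phi> = exp A\<close> the function \<open>y = \<phi> sin \<theta>\<close> solves \<open>y'' = - q y\<close>, whereas
  \<open>w(t) = \<surd>(T - t)\<close> is a positive solution of \<open>w'' = - w / (4 (T - t)\<^sup>2)\<close>. If \<open>\<theta>\<close> grew from
  \<open>0\<close> to \<open>\<pi>\<close>, the Wronskian \<open>y' w - y w'\<close> would be nondecreasing, positive at the first zero
  of \<open>y\<close> and negative at the second.
\<close>

lemma angle_less_pi:
  assumes pos: "0 < \<beta> t\<^sub>0" and t: "t \<in> {t\<^sub>0..<T}"
  shows "\<theta> t < pi"
proof (rule ccontr)
  assume "\<not> \<theta> t < pi"
  have beta_pos: "0 < \<beta> s" if "s \<in> {t\<^sub>0..<T}" for s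
    using beta_eq[OF that] pos by simp
  have theta_cont: "continuous_on {t\<^sub>0..<T} \<theta>"
    using theta_deriv by (rule DERIV_continuous_on)
  have "\<theta> t\<^sub>0 = 0" by (simp add: \<theta>_def)
  then obtain t2 where t2: "t\<^sub>0 \<le> t2" "t2 \<le> t" "\<theta> t2 = pi"
    using IVT'[of \<theta> t\<^sub>0 pi t] \<open>\<not> \<theta> t < pi\<close> t continuous_on_subset[OF theta_cont, of "{t\<^sub>0..t}"]
    by (auto simp: subset_iff)
  have sub: "{t\<^sub>0..t2} \<subseteq> {t\<^sub>0..<T}"
    using t t2 by auto
  have mono: "\<theta> r \<le> \<theta> s" if "t\<^sub>0 \<le> r" "r \<le> s" "s \<le> t2" for r s
  proof (rule nondecreasing_if_derivative_within[where f = \<theta>])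
    have *: "{r..s} \<subseteq> {t\<^sub>0..<T}"
      using that sub by auto
    show "(\<theta> has_real_derivative \<beta> x) (at x within {r..s})" "0 \<le> \<beta> x" if "x \<in> {r..s}" for x
      using that * DERIV_subset[OF theta_deriv *, of x] beta_pos[of x] by (auto simp: subset_iff)
  qed (use that in simp)
  \<comment> \<open>This is y' w - y w', with w' = - w / (2 (T - s)) inserted and the common factor
    w exp A taken out.\<close>
  define W where "W s = sqrt (T - s) * exp (A s) *
    (\<alpha> s * sin (\<theta> s) + \<beta> s * cos (\<theta> s) + sin (\<theta> s) / (2 * (T - s)))" for s
  have "W t\<^sub>0 \<le> W t2"
  proof (rule nondecreasing_if_derivative_within[where f = W])
    fix s assume s: "s \<in> {t\<^sub>0..t2}"
    then have s': "s \<in> {t\<^sub>0..<T}" "s < T"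
      using sub by auto
    note der = alpha_deriv[OF s'(1)] beta_deriv[OF s'(1)] A_deriv[OF s'(1)] theta_deriv[OF s'(1)]
    note der = der[THEN DERIV_subset, OF sub]
    \<comment> \<open>Here m = - w'/w. Since m' = 2 m^2, it follows that w'' = - m^2 w, and m^2 is
      the comparison coefficient 1 / (4 (T - s)^2).\<close>
    define m where "m = 1 / (2 * (T - s))"
    have m: "1 / (4 * (T - s)\<^sup>2) = m\<^sup>2" "1 / (2 * sqrt (T - s)) = sqrt (T - s) * m"
      using s' by (simp_all add: m_def power2_eq_square real_div_sqrt field_simps)
    have 0: "((\<lambda>s. sqrt (T - s)) has_real_derivative - (sqrt (T - s) * m)) (at s within {t\<^sub>0..t2})"
      by (rule DERIV_cong, rule DERIV_chain2[OF DERIV_real_sqrt DERIV_diff[OF DERIV_const DERIV_ident]])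
        (use s' m(2) in \<open>simp_all add: inverse_eq_divide\<close>)
    have 1: "((\<lambda>s. sqrt (T - s) * exp (A s)) has_real_derivative
        sqrt (T - s) * exp (A s) * (\<alpha> s - m)) (at s within {t\<^sub>0..t2})"
      using DERIV_mult[OF 0 DERIV_chain2[OF DERIV_exp der(3)]]
      by (rule DERIV_cong) (simp add: algebra_simps)
    have 2: "((\<lambda>s. 1 / (2 * (T - s))) has_real_derivative 2 * m\<^sup>2) (at s within {t\<^sub>0..t2})"
      using s' by (auto intro!: derivative_eq_intros simp: m_def power2_eq_square)
    have 3: "((\<lambda>s. \<alpha> s * sin (\<theta> s) + \<beta> s * cos (\<theta> s) + sin (\<theta> s) * (1 / (2 * (T - s)))) has_real_derivative
        ((\<beta> s)\<^sup>2 - (\<alpha> s)\<^sup>2 - q s) * sin (\<theta> s) + \<alpha> s * (cos (\<theta> s) * \<beta> s)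
        + (- 2 * \<alpha> s * \<beta> s * cos (\<theta> s) - \<beta> s * (sin (\<theta> s) * \<beta> s))
        + (cos (\<theta> s) * \<beta> s * m + sin (\<theta> s) * (2 * m\<^sup>2))) (at s within {t\<^sub>0..t2})"
      by (rule DERIV_cong, rule DERIV_add[OF DERIV_add[OF DERIV_mult[OF der(1) DERIV_chain2[OF DERIV_sin der(4)]]
        DERIV_mult[OF der(2) DERIV_chain2[OF DERIV_cos der(4)]]] DERIV_mult[OF DERIV_chain2[OF DERIV_sin der(4)] 2]])
        (simp add: m_def algebra_simps)
    show "(W has_real_derivative
       sqrt (T - s) * exp (A s) * sin (\<theta> s) * (1 / (4 * (T - s)\<^sup>2) - q s)) (at s within {t\<^sub>0..t2})"
      using DERIV_mult[OF 1 3] unfolding W_def m m_def[symmetric]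
      by (simp add: m_def[symmetric] algebra_simps power2_eq_square)
    \<comment> \<open>Until the half turn is completed the sine is nonnegative, so the sign of W' is
      decided by m^2 - q alone.\<close>
    have "0 \<le> \<theta> s" "\<theta> s \<le> pi"
      using mono[of t\<^sub>0 s] mono[of s t2] s t2 \<open>\<theta> t\<^sub>0 = 0\<close> by auto
    then show "0 \<le> sqrt (T - s) * exp (A s) * sin (\<theta> s) * (1 / (4 * (T - s)\<^sup>2) - q s)"
      using q_less[OF s'(1)] s' by (intro mult_nonneg_nonneg sin_ge_zero) (auto simp: field_simps)
  qed (use t2 in auto)
  moreover have "0 < W t\<^sub>0"
    using pos t0_less \<open>\<theta> t\<^sub>0 = 0\<close> by (simp add: W_def)
  moreover have "W t2 < 0"
    using beta_pos[of t2] sub t2 t by (simp add: W_def mult_pos_neg)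
  ultimately show False by simp
qed

text \<open>With \<beta> positive, \<open>\<theta>\<close> is a primitive of its absolute value, so
  the bound on the angle is a bound on the integral.\<close>

lemma integral_finite_if_pos:
  assumes pos: "0 < \<beta> t\<^sub>0"
  shows "(\<integral>\<^sup>+ t\<in>{t\<^sub>0..<T}. ennreal \<bar>\<beta> t\<bar> \<partial>lborel) \<le> ennreal pi"
proof (rule nn_integral_Ico_le[OF t0_less])
  have beta_pos: "0 < \<beta> s" if "s \<in> {t\<^sub>0..<T}" for s
    using beta_eq[OF that] pos by simp
  fix t assume t: "t \<in> {t\<^sub>0..<T}"
  then show "(\<theta> has_real_derivative \<bar>\<beta> t\<bar>) (at t within {t\<^sub>0..<T})"
    using theta_deriv beta_pos by fastforce
  show "\<theta> t - \<theta> t\<^sub>0 \<le> pi"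
    using angle_less_pi[OF pos t] by (simp add: \<theta>_def)
qed (use continuous_coeffs(2) in \<open>auto intro!: continuous_intros\<close>)

end

text \<open>Complex conjugation, which replaces \<beta> by - \<beta>, preserves the system and
  reduces a negative initial value to a positive one. A zero initial value makes \<beta> vanish
  throughout.\<close>

lemma (in axis_ode) integral_finite:
  "(\<integral>\<^sup>+ t\<in>{t\<^sub>0..<T}. ennreal \<bar>\<beta> t\<bar> \<partial>lborel) < \<infinity>"
proof -
  consider "0 < \<beta> t\<^sub>0" | "\<beta> t\<^sub>0 = 0" | "\<beta> t\<^sub>0 < 0" by linarith
  then show ?thesis
  proof cases
    case 1
    then show ?thesis
      using integral_finite_if_pos by (auto intro: le_less_trans)
  next
    case 2
    have "(\<integral>\<^sup>+ t\<in>{t\<^sub>0..<T}. ennreal \<bar>\<beta> t\<bar> \<partial>lborel) = nn_integral lborel (\<lambda>t::real. 0)"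
      using beta_eq 2 by (intro nn_integral_cong) (auto simp: indicator_def)
    then show ?thesis by simp
  next
    case 3
    interpret neg: axis_ode t\<^sub>0 T \<alpha> "\<lambda>t. - \<beta> t" q
      using t0_less q_less alpha_deriv DERIV_minus[OF beta_deriv] by unfold_locales auto
    show ?thesis
      using neg.integral_finite_if_pos 3 by (auto intro: le_less_trans)
  qed
qed

section \<open>Energy uniqueness in the meridian half-plane\<close>

text \<open>Fubini makes the r-integral the inner one, where the fundamental theorem of calculus
  leaves only equal end values. Together with its counterpart in z this takes the place of the
  divergence theorem on the rectangle.\<close>

lemma integral_partial_fst_eq_0:
  fixes G :: "real \<times> real \<Rightarrow> real"
  assumes "a \<le> b" and cont: "continuous_on (cbox (a, c) (b, d)) g"
    and der: "\<And>r z. r \<in> {a..b} \<Longrightarrow> z \<in> {c..d} \<Longrightarrow>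
      ((\<lambda>r. G (r, z)) has_real_derivative g (r, z)) (at r within {a..b})"
    and ends: "\<And>z. z \<in> {c..d} \<Longrightarrow> G (b, z) = G (a, z)"
  shows "integral (cbox (a, c) (b, d)) g = 0"
proof -
  have "integral {a..b} (\<lambda>r. g (r, z)) = 0" if "z \<in> {c..d}" for z
    using fundamental_theorem_of_calculus[OF \<open>a \<le> b\<close>, of "\<lambda>r. G (r, z)" "\<lambda>r. g (r, z)"] der ends that
    by (auto simp: has_real_derivative_iff_has_vector_derivative intro: integral_unique)
  then have "integral (cbox c d) (\<lambda>z. integral (cbox a b) (\<lambda>r. g (r, z))) = integral (cbox c d) (\<lambda>z. 0)"
    by (intro integral_cong) auto
  moreover have "integral (cbox (a, c) (b, d)) g
      = integral (cbox c d) (\<lambda>z. integral (cbox a b) (\<lambda>r. g (r, z)))"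
    using integral_swap_continuous[of a c b d "\<lambda>r z. g (r, z)"] integral_prod_continuous[OF cont] cont
    by simp
  ultimately show ?thesis by simp
qed

lemma integral_partial_snd_eq_0:
  fixes G :: "real \<times> real \<Rightarrow> real"
  assumes "c \<le> d" and cont: "continuous_on (cbox (a, c) (b, d)) g"
    and der: "\<And>r z. r \<in> {a..b} \<Longrightarrow> z \<in> {c..d} \<Longrightarrow>
      ((\<lambda>z. G (r, z)) has_real_derivative g (r, z)) (at z within {c..d})"
    and ends: "\<And>r. r \<in> {a..b} \<Longrightarrow> G (r, d) = G (r, c)"
  shows "integral (cbox (a, c) (b, d)) g = 0"
proof -
  have "integral {c..d} (\<lambda>z. g (r, z)) = 0" if "r \<in> {a..b}" for r
    using fundamental_theorem_of_calculus[OF \<open>c \<le> d\<close>, of "\<lambda>z. G (r, z)" "\<lambda>z. g (r, z)"] der ends that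
    by (auto simp: has_real_derivative_iff_has_vector_derivative intro: integral_unique)
  then have "integral (cbox a b) (\<lambda>r. integral (cbox c d) (\<lambda>z. g (r, z))) = integral (cbox a b) (\<lambda>r. 0)"
    by (intro integral_cong) auto
  then show ?thesis
    using integral_prod_continuous[OF cont] by simp
qed

lemma deriv_nth:
  assumes "(f has_vector_derivative f') (at s within S)"
  shows "((\<lambda>s. f s $ i) has_real_derivative f' $ i) (at s within S)"
  using bounded_linear.has_vector_derivative[OF bounded_linear_vec_nth assms]
  by (simp add: has_real_derivative_iff_has_vector_derivative)

lemma deriv_inner_self:
  fixes f :: "real \<Rightarrow> 'a::real_inner"
  assumes "(f has_vector_derivative f') (at s within S)"
  shows "((\<lambda>s. f s \<bullet> f s) has_real_derivative 2 * (f s \<bullet> f')) (at s within S)"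
  unfolding has_field_derivative_def
  by (rule has_derivative_eq_rhs, rule has_derivative_inner[OF
        assms[unfolded has_vector_derivative_def] assms[unfolded has_vector_derivative_def]])
    (simp add: fun_eq_iff inner_commute[of f'])

abbreviation meridian :: "(real \<times> real) set" where
  "meridian \<equiv> cbox (0, - pi) (1, pi)"

text \<open>
  The half-plane \<open>\<theta> = 0\<close> with Cartesian components, so \<open>us\<close> is the derivative
  \<open>(1/r) \<partial>\<^sub>\<theta>\<close> of the velocity in direction \<open>e\<^sub>\<theta>\<close>. The momentum equation is
  multiplied by \<open>r\<close>, the weight of the energy, and is void on the axis.
\<close>

locale meridional_euler =
  fixes \<tau> :: real
    and u ut ur us uz :: "real \<Rightarrow> real \<times> real \<Rightarrow> real^3"
    and p pr pz :: "real \<Rightarrow> real \<times> real \<Rightarrow> real"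
  assumes cont_u: "continuous_on ({0..\<tau>} \<times> meridian) (\<lambda>(t, x). u t x)"
    and cont_ut: "continuous_on ({0..\<tau>} \<times> meridian) (\<lambda>(t, x). ut t x)"
    and cont_ur: "continuous_on ({0..\<tau>} \<times> meridian) (\<lambda>(t, x). ur t x)"
    and cont_us: "continuous_on ({0..\<tau>} \<times> meridian) (\<lambda>(t, x). us t x)"
    and cont_uz: "continuous_on ({0..\<tau>} \<times> meridian) (\<lambda>(t, x). uz t x)"
    and cont_p: "\<And>t. t \<in> {0..\<tau>} \<Longrightarrow> continuous_on meridian (p t)"
    and cont_pr: "\<And>t. t \<in> {0..\<tau>} \<Longrightarrow> continuous_on meridian (pr t)"
    and cont_pz: "\<And>t. t \<in> {0..\<tau>} \<Longrightarrow> continuous_on meridian (pz t)"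
    and deriv_t: "\<And>t x. t \<in> {0..\<tau>} \<Longrightarrow> x \<in> meridian \<Longrightarrow>
      ((\<lambda>t. u t x) has_vector_derivative ut t x) (at t within {0..\<tau>})"
    and deriv_r: "\<And>t r z. t \<in> {0..\<tau>} \<Longrightarrow> r \<in> {0..1} \<Longrightarrow> z \<in> {- pi..pi} \<Longrightarrow>
      ((\<lambda>r. u t (r, z)) has_vector_derivative ur t (r, z)) (at r within {0..1})"
    and deriv_z: "\<And>t r z. t \<in> {0..\<tau>} \<Longrightarrow> r \<in> {0..1} \<Longrightarrow> z \<in> {- pi..pi} \<Longrightarrow>
      ((\<lambda>z. u t (r, z)) has_vector_derivative uz t (r, z)) (at z within {- pi..pi})"
    and deriv_p_r: "\<And>t r z. t \<in> {0..\<tau>} \<Longrightarrow> r \<in> {0..1} \<Longrightarrow> z \<in> {- pi..pi} \<Longrightarrow>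
      ((\<lambda>r. p t (r, z)) has_real_derivative pr t (r, z)) (at r within {0..1})"
    and deriv_p_z: "\<And>t r z. t \<in> {0..\<tau>} \<Longrightarrow> r \<in> {0..1} \<Longrightarrow> z \<in> {- pi..pi} \<Longrightarrow>
      ((\<lambda>z. p t (r, z)) has_real_derivative pz t (r, z)) (at z within {- pi..pi})"
    and momentum: "\<And>t r z. t \<in> {0..\<tau>} \<Longrightarrow> r \<in> {0..1} \<Longrightarrow> z \<in> {- pi..pi} \<Longrightarrow>
      r *\<^sub>R (ut t (r, z) + u t (r, z) $ 1 *\<^sub>R ur t (r, z) + u t (r, z) $ 2 *\<^sub>R us t (r, z)
        + u t (r, z) $ 3 *\<^sub>R uz t (r, z)) = - (r *\<^sub>R vector [pr t (r, z), 0, pz t (r, z)])"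
    and incompressible: "\<And>t r z. t \<in> {0..\<tau>} \<Longrightarrow> r \<in> {0..1} \<Longrightarrow> z \<in> {- pi..pi} \<Longrightarrow>
      ur t (r, z) $ 1 + us t (r, z) $ 2 + uz t (r, z) $ 3 = 0"
    and swirl: "\<And>t r z. t \<in> {0..\<tau>} \<Longrightarrow> r \<in> {0..1} \<Longrightarrow> z \<in> {- pi..pi} \<Longrightarrow>
      r *\<^sub>R us t (r, z) = vector [- (u t (r, z) $ 2), u t (r, z) $ 1, 0]"
    and wall: "\<And>t z. t \<in> {0..\<tau>} \<Longrightarrow> z \<in> {- pi..pi} \<Longrightarrow> u t (1, z) $ 1 = 0"
    and periodic_u: "\<And>t r. t \<in> {0..\<tau>} \<Longrightarrow> r \<in> {0..1} \<Longrightarrow> u t (r, pi) = u t (r, - pi)"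
    and periodic_p: "\<And>t r. t \<in> {0..\<tau>} \<Longrightarrow> r \<in> {0..1} \<Longrightarrow> p t (r, pi) = p t (r, - pi)"

section \<open>Reflection in the plane z = 0\<close>

definition flip :: "real^3 \<Rightarrow> real^3" where
  "flip y = vector [y $ 1, y $ 2, - (y $ 3)]"

definition mirror :: "real \<times> real \<Rightarrow> real \<times> real" where
  "mirror x = (fst x, - snd x)"

lemma flip_nth [simp]: "flip y $ 1 = y $ 1" "flip y $ 2 = y $ 2" "flip y $ 3 = - (y $ 3)"
  by (simp_all add: flip_def)

lemma bounded_linear_flip: "bounded_linear flip"
  by (intro linear_conv_bounded_linear[THEN iffD1] linearI) (simp_all add: vec_eq_iff forall_3)

lemmas has_vector_derivative_flip = bounded_linear.has_vector_derivative[OF bounded_linear_flip]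
lemmas continuous_on_flip = bounded_linear.continuous_on[OF bounded_linear_flip]

lemma mirror_meridian: "x \<in> meridian \<Longrightarrow> mirror x \<in> meridian"
  by (cases x) (auto simp: mirror_def)

lemma continuous_on_mirror_compose:
  fixes f :: "real \<Rightarrow> real \<times> real \<Rightarrow> 'a::topological_space"
  assumes "continuous_on (I \<times> meridian) (\<lambda>(t, x). f t x)"
  shows "continuous_on (I \<times> meridian) (\<lambda>(t, x). f t (mirror x))"
proof -
  have "continuous_on (I \<times> meridian) (\<lambda>y. (fst y, mirror (snd y)))"
    unfolding mirror_def by (intro continuous_intros)
  moreover have "(\<lambda>y. (fst y, mirror (snd y))) ` (I \<times> meridian) \<subseteq> I \<times> meridian"
    using mirror_meridian by (intro image_subsetI) (metis fst_conv mem_Times_iff snd_conv)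
  ultimately show ?thesis
    using continuous_on_compose2[OF assms] by (fastforce simp: split_beta)
qed

lemma has_vector_derivative_reflect:
  assumes "(f has_vector_derivative f') (at (- z) within {- b..b :: real})"
  shows "((\<lambda>z. f (- z)) has_vector_derivative - f') (at z within {- b..b})"
proof -
  have "(uminus has_vector_derivative - 1) (at z within {- b..b})"
    by (auto intro!: derivative_eq_intros)
  from vector_diff_chain_within[OF this, of f f'] assms show ?thesis
    by (simp add: o_def)
qed

text \<open>Reflection is an isometry and so respects the equations. The chain rule changes the sign
  of every z-derivative, and \<open>flip\<close> changes that of the third component; in the axial
  advection term and in the divergence the two signs cancel.\<close>

lemma (in meridional_euler) reflect:
  "meridional_euler \<tau> (\<lambda>t x. flip (u t (mirror x))) (\<lambda>t x. flip (ut t (mirror x))) (\<lambda>t x. flip (ur t (mirror x)))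
    (\<lambda>t x. flip (us t (mirror x))) (\<lambda>t x. - flip (uz t (mirror x))) (\<lambda>t x. p t (mirror x))
    (\<lambda>t x. pr t (mirror x)) (\<lambda>t x. - pz t (mirror x))"
proof
  have cont: "continuous_on ({0..\<tau>} \<times> meridian) (\<lambda>(t, x). flip (f t (mirror x)))"
    if "continuous_on ({0..\<tau>} \<times> meridian) (\<lambda>(t, x). f t x)" for f
    using continuous_on_flip[OF continuous_on_mirror_compose[OF that]] by (simp add: split_beta)
  show "continuous_on ({0..\<tau>} \<times> meridian) (\<lambda>(t, x). flip (u t (mirror x)))"
    "continuous_on ({0..\<tau>} \<times> meridian) (\<lambda>(t, x). flip (ut t (mirror x)))"
    "continuous_on ({0..\<tau>} \<times> meridian) (\<lambda>(t, x). flip (ur t (mirror x)))"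
    "continuous_on ({0..\<tau>} \<times> meridian) (\<lambda>(t, x). flip (us t (mirror x)))"
    by (intro cont cont_u cont_ut cont_ur cont_us)+
  show "continuous_on ({0..\<tau>} \<times> meridian) (\<lambda>(t, x). - flip (uz t (mirror x)))"
    using continuous_on_minus[OF cont[OF cont_uz]] by (simp add: split_beta)
next
  fix t assume t: "t \<in> {0..\<tau>}"
  have cont: "continuous_on meridian (\<lambda>x. f (mirror x))" if "continuous_on meridian f" for f :: "real \<times> real \<Rightarrow> real"
  proof (rule continuous_on_compose2[OF that])
    show "continuous_on meridian mirror"
      unfolding mirror_def by (intro continuous_intros)
    show "mirror ` meridian \<subseteq> meridian"
      using mirror_meridian by blast
  qed
  show "continuous_on meridian (\<lambda>x. p t (mirror x))" "continuous_on meridian (\<lambda>x. pr t (mirror x))"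
    by (intro cont cont_p cont_pr t)+
  show "continuous_on meridian (\<lambda>x. - pz t (mirror x))"
    by (intro continuous_on_minus cont cont_pz t)
  show "((\<lambda>t. flip (u t (mirror x))) has_vector_derivative flip (ut t (mirror x))) (at t within {0..\<tau>})"
    if "x \<in> meridian" for x
    by (intro has_vector_derivative_flip deriv_t t mirror_meridian that)
  fix r assume r: "r \<in> {0..1 :: real}"
  show "flip (u t (mirror (r, pi))) = flip (u t (mirror (r, - pi)))"
    "p t (mirror (r, pi)) = p t (mirror (r, - pi))"
    using periodic_u[OF t r] periodic_p[OF t r] by (simp_all add: mirror_def)
  fix z assume z: "z \<in> {- pi..pi}"
  then have z': "- z \<in> {- pi..pi}" by simp
  note hyps = t r z'
  show "((\<lambda>r. flip (u t (mirror (r, z)))) has_vector_derivative flip (ur t (mirror (r, z)))) (at r within {0..1})"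
    unfolding mirror_def fst_conv snd_conv by (intro has_vector_derivative_flip deriv_r hyps)
  show "((\<lambda>z. flip (u t (mirror (r, z)))) has_vector_derivative - flip (uz t (mirror (r, z)))) (at z within {- pi..pi})"
    unfolding mirror_def fst_conv snd_conv
    by (intro has_vector_derivative_reflect[where f = "\<lambda>z. flip (u t (r, z))"] has_vector_derivative_flip deriv_z hyps)
  show "((\<lambda>r. p t (mirror (r, z))) has_real_derivative pr t (mirror (r, z))) (at r within {0..1})"
    unfolding mirror_def fst_conv snd_conv by (intro deriv_p_r hyps)
  show "((\<lambda>z. p t (mirror (r, z))) has_real_derivative - pz t (mirror (r, z))) (at z within {- pi..pi})"
    using has_vector_derivative_reflect[of "\<lambda>z. p t (r, z)" "pz t (r, - z)" z pi] deriv_p_z[OF hyps]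
    by (simp add: mirror_def has_real_derivative_iff_has_vector_derivative)
  show "flip (ur t (mirror (r, z))) $ 1 + flip (us t (mirror (r, z))) $ 2 + (- flip (uz t (mirror (r, z)))) $ 3 = 0"
    using incompressible[OF hyps] by (simp add: mirror_def)
  show "r *\<^sub>R flip (us t (mirror (r, z)))
      = vector [- (flip (u t (mirror (r, z))) $ 2), flip (u t (mirror (r, z))) $ 1, 0]"
    using swirl[OF hyps] by (auto simp: mirror_def vec_eq_iff forall_3)
  have mom: "r * (ut t (r, - z) $ i + u t (r, - z) $ 1 * ur t (r, - z) $ i + u t (r, - z) $ 2 * us t (r, - z) $ i
      + u t (r, - z) $ 3 * uz t (r, - z) $ i) = - (r * (vector [pr t (r, - z), 0, pz t (r, - z)] :: real^3) $ i)" for i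
    using arg_cong[OF momentum[OF hyps], of "\<lambda>y. y $ i"] by simp
  show "r *\<^sub>R (flip (ut t (mirror (r, z))) + flip (u t (mirror (r, z))) $ 1 *\<^sub>R flip (ur t (mirror (r, z)))
      + flip (u t (mirror (r, z))) $ 2 *\<^sub>R flip (us t (mirror (r, z)))
      + flip (u t (mirror (r, z))) $ 3 *\<^sub>R - flip (uz t (mirror (r, z))))
      = - (r *\<^sub>R vector [pr t (mirror (r, z)), 0, - pz t (mirror (r, z))])"
    using mom[of 1] mom[of 2] mom[of 3]
    by (simp add: mirror_def vec_eq_iff forall_3 algebra_simps)
next
  show "flip (u t (mirror (1, z))) $ 1 = 0" if "t \<in> {0..\<tau>}" "z \<in> {- pi..pi}" for t z
    using wall[OF that(1), of "- z"] that by (simp add: mirror_def)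
qed

section \<open>Energy balance for the difference of two flows\<close>

locale two_meridional_flows =
  u: meridional_euler \<tau> u ut ur us uz p pr pz + v: meridional_euler \<tau> v vt vr vs vz p' pr' pz'
  for \<tau> u ut ur us uz p pr pz v vt vr vs vz p' pr' pz' +
  assumes same_initial: "\<And>x. x \<in> meridian \<Longrightarrow> u 0 x = v 0 x"
begin

definition "w t x = u t x - v t x"
definition "wt t x = ut t x - vt t x"
definition "wr t x = ur t x - vr t x"
definition "ws t x = us t x - vs t x"
definition "wz t x = uz t x - vz t x"
definition "q t x = p t x - p' t x"
definition "qr t x = pr t x - pr' t x"
definition "qz t x = pz t x - pz' t x"

lemmas diff_defs = w_def wt_def wr_def ws_def wz_def q_def qr_def qz_def

definition "energy t x = fst x * (w t x \<bullet> w t x)"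
definition "energy_t t x = fst x * (2 * (w t x \<bullet> wt t x))"
text \<open>Radial component of the energy flux r (|w|^2 u + 2 q w): transport by \<open>u\<close>
  and work of the pressure difference. \<open>flux_z\<close> is its axial component;
  \<open>flux_rr\<close> and \<open>flux_zz\<close> are the derivatives of these two in r and in
  z.\<close>

definition "flux_r t x = fst x * (u t x $ 1 * (w t x \<bullet> w t x) + 2 * w t x $ 1 * q t x)"
definition "flux_z t x = fst x * (u t x $ 3 * (w t x \<bullet> w t x) + 2 * w t x $ 3 * q t x)"
definition "flux_rr t x = u t x $ 1 * (w t x \<bullet> w t x) + 2 * w t x $ 1 * q t x
  + fst x * (ur t x $ 1 * (w t x \<bullet> w t x) + u t x $ 1 * (2 * (w t x \<bullet> wr t x))
    + 2 * wr t x $ 1 * q t x + 2 * w t x $ 1 * qr t x)"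
definition "flux_zz t x =
  fst x * (uz t x $ 3 * (w t x \<bullet> w t x) + u t x $ 3 * (2 * (w t x \<bullet> wz t x))
    + 2 * wz t x $ 3 * q t x + 2 * w t x $ 3 * qz t x)"
text \<open>The difference of the nonlinear terms is (u . grad) w + (w . grad) v. The first summand
  is absorbed into the fluxes; the second, tested with 2 w, is \<open>stretch\<close>.\<close>

definition "stretch t x = 2 * (w t x \<bullet> (w t x $ 1 *\<^sub>R vr t x + w t x $ 2 *\<^sub>R vs t x + w t x $ 3 *\<^sub>R vz t x))"

lemma continuous_at_time:
  assumes "continuous_on ({0..\<tau>} \<times> meridian) (\<lambda>(t, x). f t x)" "t \<in> {0..\<tau>}"
  shows "continuous_on meridian (f t)"
proof -
  have "Pair t ` meridian \<subseteq> {0..\<tau>} \<times> meridian"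
    using assms(2) by blast
  then show ?thesis
    using continuous_on_compose2[OF assms(1), of meridian "Pair t"] by (simp add: continuous_on_Pair)
qed

lemmas cont_joint = u.cont_u u.cont_ut u.cont_ur u.cont_us u.cont_uz v.cont_u v.cont_ut v.cont_ur v.cont_us v.cont_uz
lemmas cont_time = cont_joint[THEN continuous_at_time]
lemmas cont_pressure = u.cont_p u.cont_pr u.cont_pz v.cont_p v.cont_pr v.cont_pz

lemma cont_energy: "continuous_on ({0..\<tau>} \<times> meridian) (\<lambda>(t, x). energy t x)"
  and cont_energy_t: "continuous_on ({0..\<tau>} \<times> meridian) (\<lambda>(t, x). energy_t t x)"
  using cont_joint unfolding energy_def energy_t_def diff_defs split_beta
  by (auto intro!: continuous_intros)

lemma cont_flux:
  assumes "t \<in> {0..\<tau>}"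
  shows "continuous_on meridian (flux_rr t)" "continuous_on meridian (flux_zz t)"
  unfolding flux_rr_def flux_zz_def diff_defs
  by (intro continuous_intros cont_time[OF assms] cont_pressure[OF assms])+

text \<open>The difference of the momentum equations is tested with 2 w. Incompressibility of
  \<open>u\<close> and of w turns the transport and pressure terms into a divergence, and only
  \<open>stretch\<close> remains.\<close>

lemma energy_balance:
  assumes t: "t \<in> {0..\<tau>}" and x: "x \<in> meridian"
  shows "energy_t t x + flux_rr t x + flux_zz t x = - (fst x * stretch t x)"
proof -
  obtain r z where x_eq: "x = (r, z)" and rz: "r \<in> {0..1}" "z \<in> {- pi..pi}"
    using x by (cases x) auto
  note hyps = t rz
  let ?W = "w t x"
  have mom: "r *\<^sub>R wt t x = - (r * u t x $ 1) *\<^sub>R wr t x - u t x $ 2 *\<^sub>R (r *\<^sub>R ws t x) - (r * u t x $ 3) *\<^sub>R wz t x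
      - r *\<^sub>R (?W $ 1 *\<^sub>R vr t x + ?W $ 2 *\<^sub>R vs t x + ?W $ 3 *\<^sub>R vz t x) - r *\<^sub>R vector [qr t x, 0, qz t x]"
    (is "_ = ?rhs")
  proof -
    have "r *\<^sub>R (vector [qr t x, 0, qz t x] :: real^3)
        = r *\<^sub>R vector [pr t x, 0, pz t x] - r *\<^sub>R vector [pr' t x, 0, pz' t x] "
      by (simp add: vec_eq_iff forall_3 qr_def qz_def algebra_simps)
    note pressure = this
    show ?thesis
    proof (subst vec_eq_iff, rule allI)
      fix i
      show "(r *\<^sub>R wt t x) $ i = ?rhs $ i"
        using arg_cong[OF pressure, of "\<lambda>y. y $ i"] arg_cong[OF u.momentum[OF hyps], of "\<lambda>y. y $ i"]
          arg_cong[OF v.momentum[OF hyps], of "\<lambda>y. y $ i"]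
        unfolding x_eq[symmetric] by (simp add: diff_defs algebra_simps)
    qed
  qed
  have swirl: "r *\<^sub>R ws t x = vector [- (?W $ 2), ?W $ 1, 0]"
    using u.swirl[OF hyps] v.swirl[OF hyps]
    by (auto simp: x_eq diff_defs vec_eq_iff forall_3 algebra_simps)
  \<comment> \<open>The azimuthal derivative of an axisymmetric field is an infinitesimal rotation
    of the field, hence orthogonal to it.\<close>
  have orth: "?W \<bullet> (r *\<^sub>R ws t x) = 0"
    unfolding swirl by (simp add: inner_vec_def sum_3)
  have grad: "?W \<bullet> vector [qr t x, 0, qz t x] = ?W $ 1 * qr t x + ?W $ 3 * qz t x"
    by (simp add: inner_vec_def sum_3)
  have "energy_t t x = 2 * (?W \<bullet> (r *\<^sub>R wt t x))"
    by (simp add: energy_t_def x_eq)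
  also have "\<dots> = - 2 * r * u t x $ 1 * (?W \<bullet> wr t x) - 2 * r * u t x $ 3 * (?W \<bullet> wz t x)
      - r * stretch t x - 2 * r * (?W $ 1 * qr t x + ?W $ 3 * qz t x)"
    unfolding mom inner_diff_right inner_minus_right inner_scaleR_right[of _ "u t x $ 2"] orth
      inner_scaleR_right[of _ _ "vector [qr t x, 0, qz t x]"] grad stretch_def
    by (simp add: inner_diff_right inner_add_right algebra_simps)
  finally have et: "energy_t t x = \<dots>" .
  \<comment> \<open>This is r div u: by the swirl identity the azimuthal derivative contributes u_1
    / r to the divergence.\<close>
  have du: "u t x $ 1 + r * ur t x $ 1 + r * uz t x $ 3 = 0"
  proof -
    have "r * us t x $ 2 = u t x $ 1"
      using arg_cong[OF u.swirl[OF hyps], of "\<lambda>y. y $ 2"] by (simp add: x_eq)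
    then show ?thesis
      using arg_cong[OF u.incompressible[OF hyps], of "\<lambda>y. r * y"] by (simp add: x_eq algebra_simps)
  qed
  have dw: "?W $ 1 + r * wr t x $ 1 + r * wz t x $ 3 = 0"
  proof -
    have "r * ws t x $ 2 = ?W $ 1"
      using arg_cong[OF swirl, of "\<lambda>y. y $ 2"] by simp
    moreover have "wr t x $ 1 + ws t x $ 2 + wz t x $ 3 = 0"
      using u.incompressible[OF hyps] v.incompressible[OF hyps] by (simp add: x_eq diff_defs)
    then have "r * (wr t x $ 1 + ws t x $ 2 + wz t x $ 3) = 0" by simp
    ultimately show ?thesis by (simp add: algebra_simps)
  qed
  have "flux_rr t x + flux_zz t x = (u t x $ 1 + r * ur t x $ 1 + r * uz t x $ 3) * (?W \<bullet> ?W)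
      + 2 * q t x * (?W $ 1 + r * wr t x $ 1 + r * wz t x $ 3)
      + 2 * r * u t x $ 1 * (?W \<bullet> wr t x) + 2 * r * u t x $ 3 * (?W \<bullet> wz t x)
      + 2 * r * (?W $ 1 * qr t x + ?W $ 3 * qz t x)"
    by (simp add: flux_rr_def flux_zz_def x_eq algebra_simps)
  then show ?thesis
    unfolding et du dw by (simp add: x_eq)
qed

lemma deriv_w_r:
  assumes "t \<in> {0..\<tau>}" "r \<in> {0..1}" "z \<in> {- pi..pi}"
  shows "((\<lambda>r. w t (r, z)) has_vector_derivative wr t (r, z)) (at r within {0..1})"
  unfolding w_def wr_def by (intro has_vector_derivative_diff u.deriv_r v.deriv_r assms)

lemma deriv_w_z:
  assumes "t \<in> {0..\<tau>}" "r \<in> {0..1}" "z \<in> {- pi..pi}"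
  shows "((\<lambda>z. w t (r, z)) has_vector_derivative wz t (r, z)) (at z within {- pi..pi})"
  unfolding w_def wz_def by (intro has_vector_derivative_diff u.deriv_z v.deriv_z assms)

text \<open>The radial flux vanishes on the axis because of its factor r and on the wall because
  both radial velocities vanish there; the axial flux takes equal values at both ends by
  periodicity.\<close>

lemma integral_flux_eq_0:
  assumes t: "t \<in> {0..\<tau>}"
  shows "integral meridian (flux_rr t) = 0" "integral meridian (flux_zz t) = 0"
proof -
  show "integral meridian (flux_rr t) = 0"
  proof (rule integral_partial_fst_eq_0[where G = "flux_r t"])
    fix r z :: real assume rz: "r \<in> {0..1}" "z \<in> {- pi..pi}"
    note hyps = t rz
    show "((\<lambda>r. flux_r t (r, z)) has_real_derivative flux_rr t (r, z)) (at r within {0..1})"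
      using DERIV_mult[OF DERIV_ident DERIV_add[OF
        DERIV_mult[OF deriv_nth[OF u.deriv_r[OF hyps], of 1] deriv_inner_self[OF deriv_w_r[OF hyps]]]
        DERIV_mult[OF DERIV_cmult[OF deriv_nth[OF deriv_w_r[OF hyps], of 1], of 2] DERIV_diff[OF u.deriv_p_r[OF hyps] v.deriv_p_r[OF hyps]]]]]
      unfolding flux_r_def flux_rr_def q_def qr_def fst_conv
      by (rule DERIV_cong) (simp add: algebra_simps)
  next
    fix z :: real assume z: "z \<in> {- pi..pi}"
    show "flux_r t (1, z) = flux_r t (0, z)"
      using u.wall[OF t z] v.wall[OF t z] by (simp add: flux_r_def w_def)
  qed (use cont_flux t in auto)
  show "integral meridian (flux_zz t) = 0"
  proof (rule integral_partial_snd_eq_0[where G = "flux_z t"])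
    fix r z :: real assume rz: "r \<in> {0..1}" "z \<in> {- pi..pi}"
    note hyps = t rz
    show "((\<lambda>z. flux_z t (r, z)) has_real_derivative flux_zz t (r, z)) (at z within {- pi..pi})"
      using DERIV_cmult[OF DERIV_add[OF
        DERIV_mult[OF deriv_nth[OF u.deriv_z[OF hyps], of 3] deriv_inner_self[OF deriv_w_z[OF hyps]]]
        DERIV_mult[OF DERIV_cmult[OF deriv_nth[OF deriv_w_z[OF hyps], of 3], of 2] DERIV_diff[OF u.deriv_p_z[OF hyps] v.deriv_p_z[OF hyps]]]], of r]
      unfolding flux_z_def flux_zz_def q_def qz_def fst_conv
      by (rule DERIV_cong) (simp add: algebra_simps)
  next
    fix r :: real assume r: "r \<in> {0..1}"
    show "flux_z t (r, pi) = flux_z t (r, - pi)"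
      using u.periodic_u[OF t r] v.periodic_u[OF t r] u.periodic_p[OF t r] v.periodic_p[OF t r]
      by (simp add: flux_z_def w_def q_def)
  qed (use cont_flux t in auto)
qed

text \<open>The derivatives of v are bounded by compactness, which is why the comparison runs on a
  closed time interval. Such a bound need not persist up to a blow-up time.\<close>

lemma stretch_bounded:
  obtains K where "\<And>t x. t \<in> {0..\<tau>} \<Longrightarrow> x \<in> meridian \<Longrightarrow> - stretch t x \<le> K * (w t x \<bullet> w t x)"
proof -
  have "\<exists>B. \<forall>t\<in>{0..\<tau>}. \<forall>x\<in>meridian. norm (f t x) \<le> B"
    if "continuous_on ({0..\<tau>} \<times> meridian) (\<lambda>(t, x). f t x)" for f :: "real \<Rightarrow> real \<times> real \<Rightarrow> real^3"
  proof -
    have "bounded ((\<lambda>(t, x). f t x) ` ({0..\<tau>} \<times> meridian))"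
      by (intro compact_imp_bounded compact_continuous_image that compact_Times) auto
    then show ?thesis
      unfolding bounded_iff by (auto simp del: cbox_Pair_iff)
  qed
  from this[OF v.cont_ur] this[OF v.cont_us] this[OF v.cont_uz] obtain A B C where
    bound: "\<And>t x. t \<in> {0..\<tau>} \<Longrightarrow> x \<in> meridian \<Longrightarrow> norm (vr t x) \<le> A \<and> norm (vs t x) \<le> B \<and> norm (vz t x) \<le> C"
    by blast
  have "- stretch t x \<le> 2 * (A + B + C) * (w t x \<bullet> w t x)" if tx: "t \<in> {0..\<tau>}" "x \<in> meridian" for t x
  proof -
    let ?n = "norm (w t x)"
    let ?s = "w t x $ 1 *\<^sub>R vr t x + w t x $ 2 *\<^sub>R vs t x + w t x $ 3 *\<^sub>R vz t x"
    have "norm ?s \<le> ?n * A + ?n * B + ?n * C"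
      using bound[OF tx] component_le_norm_cart[of "w t x"]
      by (intro norm_triangle_le add_mono) (auto intro!: mult_mono)
    then have "?n * norm ?s \<le> ?n * (?n * A + ?n * B + ?n * C)"
      by (intro mult_left_mono) auto
    moreover have "- (w t x \<bullet> ?s) \<le> ?n * norm ?s"
      using Cauchy_Schwarz_ineq2[of "w t x" ?s] by linarith
    moreover have "w t x \<bullet> w t x = ?n * ?n"
      by (simp add: dot_square_norm power2_eq_square)
    ultimately show ?thesis
      unfolding stretch_def by (simp add: algebra_simps)
  qed
  then show ?thesis by (rule that)
qed

text \<open>By Gronwall the integral of the energy density is zero, and a continuous nonnegative
  density with zero integral vanishes. The weight r then permits division only off the axis.\<close>

theorem unique:
  assumes t: "t \<in> {0..\<tau>}" and x: "x \<in> meridian" and pos: "0 < fst x"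
  shows "u t x = v t x"
proof -
  obtain K where K: "\<And>t x. t \<in> {0..\<tau>} \<Longrightarrow> x \<in> meridian \<Longrightarrow> - stretch t x \<le> K * (w t x \<bullet> w t x)"
    using stretch_bounded by blast
  have cont: "continuous_on meridian (energy s)" "continuous_on meridian (energy_t s)" if "s \<in> {0..\<tau>}" for s
    using continuous_at_time that cont_energy cont_energy_t by auto
  have int: "f integrable_on meridian" if "continuous_on meridian f" for f :: "real \<times> real \<Rightarrow> real"
    using that by (rule integrable_continuous)
  have "integral meridian (energy t) \<le> 0"
  proof (rule gronwall_nonpos[OF _ _ _ t, where h' = "\<lambda>s. integral meridian (energy_t s)" and K = K])
    fix s assume s: "s \<in> {0..\<tau>}"
    show "((\<lambda>t. integral meridian (energy t)) has_real_derivative integral meridian (energy_t s)) (at s within {0..\<tau>})"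
    proof (rule leibniz_rule_field_derivative)
      fix t x assume tx: "t \<in> {0..\<tau>}" "x \<in> meridian"
      have "((\<lambda>t. w t x) has_vector_derivative wt t x) (at t within {0..\<tau>})"
        unfolding w_def wt_def by (intro has_vector_derivative_diff u.deriv_t v.deriv_t tx)
      then show "((\<lambda>t. energy t x) has_real_derivative energy_t t x) (at t within {0..\<tau>})"
        unfolding energy_def energy_t_def by (intro DERIV_cmult deriv_inner_self)
    qed (use int cont s cont_energy_t in auto)
    \<comment> \<open>Adding the flux derivatives does not change the integral and brings the
      integrand into the form of \<open>energy_balance\<close>.\<close>
    have "integral meridian (energy_t s) = integral meridian (\<lambda>x. energy_t s x + flux_rr s x + flux_zz s x)"
      using integral_flux_eq_0[OF s] cont[OF s] cont_flux[OF s]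
      by (simp add: integral_add integrable_add int)
    also have "\<dots> \<le> integral meridian (\<lambda>x. K * energy s x)"
    proof (rule integral_le)
      fix x assume x: "x \<in> meridian"
      then have "fst x * (- stretch s x) \<le> fst x * (K * (w s x \<bullet> w s x))"
        using K[OF s x] by (intro mult_left_mono) (auto simp: cbox_Pair_eq)
      then show "energy_t s x + flux_rr s x + flux_zz s x \<le> K * energy s x"
        using energy_balance[OF s x] by (simp add: energy_def algebra_simps)
    qed (intro int continuous_intros cont[OF s] cont_flux[OF s])+
    finally show "integral meridian (energy_t s) \<le> K * integral meridian (energy s)"
      by simp
  next
    show "integral meridian (energy 0) \<le> 0"
      using same_initial by (simp add: energy_def w_def cong: integral_cong)
  qed
  moreover have nonneg: "0 \<le> energy t y" if "y \<in> meridian" for y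
    using that by (cases y) (auto simp: energy_def)
  ultimately have "integral meridian (energy t) = 0"
    using integral_nonneg[OF int[OF cont(1)[OF t]]] by fastforce
  \<comment> \<open>Witness that the rectangle has nonempty interior; on a degenerate one a zero
    integral would carry no information.\<close>
  moreover have "(1 / 2, 0) \<in> box (0, - pi) (1 :: real, pi)"
    by (auto simp: mem_box Basis_prod_def)
  ultimately have "energy t x = 0"
    using integral_cbox_eq_0_iff[OF cont(1)[OF t], THEN iffD1] nonneg x by auto
  then show ?thesis
    using pos by (simp add: energy_def w_def)
qed

end

section \<open>The Euler equations in spacetime derivatives\<close>

lemma has_vector_derivative_along:
  assumes "(f has_derivative D) (at (\<gamma> s) within S)"
    and "(\<gamma> has_vector_derivative v) (at s within I)" and "\<gamma> ` I \<subseteq> S"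
  shows "((\<lambda>s. f (\<gamma> s)) has_vector_derivative D v) (at s within I)"
  using vector_derivative_diff_chain_within[OF assms(2) has_derivative_subset[OF assms(1,3)]]
  by (simp add: o_def)

text \<open>The difference g of two derivatives is a derivative of the zero function, so following
  segments in \<open>S\<close> gives g (y - x) = 0 for every y in \<open>S\<close>. Differences of
  such vectors cover a ball, hence all directions. This settles uniqueness at boundary points
  too.\<close>

lemma has_derivative_within_convex_unique:
  fixes f :: "'a::real_normed_vector \<Rightarrow> 'b::real_normed_vector"
  assumes "convex S" "interior S \<noteq> {}" "x \<in> S"
    and f': "(f has_derivative f') (at x within S)" and f'': "(f has_derivative f'') (at x within S)"
  shows "f' = f''"
proof -
  define g where "g v = f' v - f'' v" for v
  have g: "((\<lambda>_. 0) has_derivative g) (at x within S)"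
    using has_derivative_diff[OF f' f''] by (simp add: g_def[abs_def])
  then interpret g: bounded_linear g
    by (rule has_derivative_bounded_linear)
  have zero: "g (y - x) = 0" if "y \<in> S" for y
  proof -
    have "((\<lambda>s. x + s *\<^sub>R (y - x)) has_vector_derivative y - x) (at 0 within {0..1 :: real})"
      by (auto intro!: derivative_eq_intros)
    moreover have "(\<lambda>s. x + s *\<^sub>R (y - x)) ` {0..1} \<subseteq> S"
    proof (intro image_subsetI)
      fix s :: real assume "s \<in> {0..1}"
      then show "x + s *\<^sub>R (y - x) \<in> S"
        using convexD_alt[OF \<open>convex S\<close> \<open>x \<in> S\<close> \<open>y \<in> S\<close>, of s] by (simp add: algebra_simps)
    qed
    ultimately have "((\<lambda>s :: real. 0) has_vector_derivative g (y - x)) (at 0 within {0..1})"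
      using g by (intro has_vector_derivative_along[where f = "\<lambda>_. 0" and \<gamma> = "\<lambda>s. x + s *\<^sub>R (y - x)"]) auto
    then show ?thesis
      by (intro vector_derivative_unique_within[OF _ _ has_vector_derivative_const]) (auto simp: trivial_limit_within islimpt_Icc)
  qed
  obtain c e where ce: "0 < e" "ball c e \<subseteq> S"
    using \<open>interior S \<noteq> {}\<close> by (auto simp: mem_interior)
  have "g v = 0" for v
  proof (cases "v = 0")
    case False
    define k where "k = e / (2 * norm v)"
    have k: "0 < k" "norm (k *\<^sub>R v) < e"
      using False ce by (simp_all add: k_def)
    then have "c \<in> S" "c + k *\<^sub>R v \<in> S"
      using ce by (auto simp: subset_iff dist_norm)
    then have "g (c + k *\<^sub>R v - x) - g (c - x) = 0"
      using zero by simp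
    then show ?thesis
      using k by (simp add: g.diff[symmetric] g.scaleR algebra_simps)
  qed (simp add: g.zero)
  then show ?thesis
    by (auto simp: g_def)
qed

section \<open>The cylinder, derivatives within it, and the cylindrical frame\<close>

lemma cylinder_vimage: "cylinder = (\<lambda>x. (x $ 1, x $ 2)) -` cball 0 1"
  by (auto simp: cylinder_def norm_Pair)

lemma convex_cylinder: "convex cylinder"
  unfolding cylinder_vimage
  by (intro convex_linear_vimage convex_cball linearI) auto

lemma closed_cylinder: "closed cylinder"
  unfolding cylinder_vimage by (intro closed_vimage continuous_intros) auto

lemma zero_in_interior_cylinder: "0 \<in> interior cylinder"
proof (rule interiorI)
  show "open ((\<lambda>x :: real^3. (x $ 1, x $ 2)) -` ball 0 1)"
    by (intro open_vimage continuous_intros) auto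
qed (auto simp: cylinder_def norm_Pair)

lemma zero_in_cylinder: "0 \<in> cylinder"
  using zero_in_interior_cylinder interior_subset by blast

lemma has_derivative_cylinder_unique:
  fixes f :: "real^3 \<Rightarrow> 'b::real_normed_vector"
  assumes "x \<in> cylinder" "(f has_derivative f') (at x within cylinder)" "(f has_derivative f'') (at x within cylinder)"
  shows "f' = f''"
  using has_derivative_within_convex_unique[OF convex_cylinder _ assms] zero_in_interior_cylinder by auto

text \<open>Uniqueness identifies the chosen derivative inside \<open>jac\<close> and
  \<open>grad\<close> with any derivative at hand, also on the wall.\<close>

lemma frechet_derivative_cylinder:
  fixes f :: "real^3 \<Rightarrow> 'b::real_normed_vector"
  assumes "x \<in> cylinder" "(f has_derivative f') (at x within cylinder)"
  shows "frechet_derivative f (at x within cylinder) = f'"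
  using has_derivative_cylinder_unique[OF assms(1) _ assms(2)] assms(2) frechet_derivative_works
  by (metis differentiableI)

lemma cyl_nth [simp]: "cyl r \<theta> z $ 1 = r * cos \<theta>" "cyl r \<theta> z $ 2 = r * sin \<theta>" "cyl r \<theta> z $ 3 = z"
  by (simp_all add: cyl_def)

lemma e_nth [simp]:
  "e_r \<theta> $ 1 = cos \<theta>" "e_r \<theta> $ 2 = sin \<theta>" "e_r \<theta> $ 3 = 0"
  "e_theta \<theta> $ 1 = - sin \<theta>" "e_theta \<theta> $ 2 = cos \<theta>" "e_theta \<theta> $ 3 = 0"
  "e_z $ 1 = 0" "e_z $ 2 = 0" "e_z $ 3 = 1"
  by (simp_all add: e_r_def e_theta_def e_z_def)

lemma axis_nth3 [simp]:
  "axis 1 (1::real) $ (2::3) = 0" "axis 1 (1::real) $ (3::3) = 0" "axis 2 (1::real) $ (1::3) = 0"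
  "axis 2 (1::real) $ (3::3) = 0" "axis 3 (1::real) $ (1::3) = 0" "axis 3 (1::real) $ (2::3) = 0"
  "axis i (1::real) $ i = 1"
  by (simp_all add: axis_def)

lemma cyl_in_cylinder: "r \<in> {0..1} \<Longrightarrow> cyl r \<theta> z \<in> cylinder"
  by (simp add: cylinder_def power_mult_distrib flip: distrib_left) (simp add: power_le_one)

lemma cyl_0_eq_0: "cyl 0 \<theta> 0 = 0"
  by (simp add: vec_eq_iff forall_3)

lemma cyl_deriv_r: "((\<lambda>r. cyl r \<theta> z) has_vector_derivative e_r \<theta>) (at r within I)"
proof -
  have "(\<lambda>r. cyl r \<theta> z) = (\<lambda>r. r *\<^sub>R e_r \<theta> + z *\<^sub>R e_z)"
    by (auto simp: vec_eq_iff forall_3)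
  then show ?thesis
    by (auto intro!: derivative_eq_intros)
qed

lemma cyl_deriv_z: "((\<lambda>z. cyl r \<theta> z) has_vector_derivative e_z) (at z within I)"
proof -
  have "(\<lambda>z. cyl r \<theta> z) = (\<lambda>z. r *\<^sub>R e_r \<theta> + z *\<^sub>R e_z)"
    by (auto simp: vec_eq_iff forall_3)
  then show ?thesis
    by (auto intro!: derivative_eq_intros)
qed

lemma e_r_deriv: "(e_r has_vector_derivative e_theta \<theta>) (at \<theta> within I)"
  and e_theta_deriv: "(e_theta has_vector_derivative - e_r \<theta>) (at \<theta> within I)"
proof -
  have trig: "((\<lambda>\<theta>. cos \<theta> *\<^sub>R v) has_vector_derivative - sin \<theta> *\<^sub>R v) (at \<theta> within I)"
    "((\<lambda>\<theta>. sin \<theta> *\<^sub>R v) has_vector_derivative cos \<theta> *\<^sub>R v) (at \<theta> within I)" for v :: "real^3"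
    by (rule has_vector_derivative_eq_rhs, rule has_vector_derivative_scaleR[OF
          has_field_derivative_at_within[OF DERIV_cos] has_vector_derivative_const], simp,
        rule has_vector_derivative_eq_rhs, rule has_vector_derivative_scaleR[OF
          has_field_derivative_at_within[OF DERIV_sin] has_vector_derivative_const], simp)
  have eqs: "e_r \<phi> = cos \<phi> *\<^sub>R axis 1 1 + sin \<phi> *\<^sub>R axis 2 1"
    "e_theta \<phi> = cos \<phi> *\<^sub>R axis 2 1 - sin \<phi> *\<^sub>R axis 1 1"
    "- e_r \<phi> = - sin \<phi> *\<^sub>R axis 2 1 - cos \<phi> *\<^sub>R axis 1 1" for \<phi>
    by (auto simp: vec_eq_iff forall_3)
  show "(e_r has_vector_derivative e_theta \<theta>) (at \<theta> within I)"
    using has_vector_derivative_add[OF trig(1)[of "axis 1 1"] trig(2)[of "axis 2 1"]]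
    unfolding eqs(1,2)[abs_def] by (simp add: add.commute)
  show "(e_theta has_vector_derivative - e_r \<theta>) (at \<theta> within I)"
    using has_vector_derivative_diff[OF trig(1)[of "axis 2 1"] trig(2)[of "axis 1 1"]]
    unfolding eqs(3) eqs(2)[abs_def] by simp
qed

lemma cyl_deriv_theta: "((\<lambda>\<theta>. cyl r \<theta> z) has_vector_derivative r *\<^sub>R e_theta \<theta>) (at \<theta> within I)"
proof -
  have "(\<lambda>\<theta>. cyl r \<theta> z) = (\<lambda>\<theta>. r *\<^sub>R e_r \<theta> + z *\<^sub>R e_z)"
    by (auto simp: vec_eq_iff forall_3)
  then show ?thesis
    using e_r_deriv by (auto intro!: derivative_eq_intros)
qed

lemma e_at_0: "e_r 0 = axis 1 1" "e_theta 0 = axis 2 1" "e_z = axis 3 1"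
  by (simp_all add: vec_eq_iff forall_3)

lemma Basis_spacetime:
  "(1, 0) \<in> (Basis :: (real \<times> (real^3)) set)" "(0, axis i 1) \<in> (Basis :: (real \<times> (real^3)) set)"
  by (auto simp: Basis_prod_def Basis_vec_def)

lemma vec3_expand: "x = x $ 1 *\<^sub>R axis 1 1 + x $ 2 *\<^sub>R axis 2 1 + x $ 3 *\<^sub>R axis 3 (1 :: real)" for x :: "real^3"
  by (simp add: vec_eq_iff forall_3)

section \<open>First and second derivatives of a solution\<close>

locale euler_flow =
  fixes T :: real
    and a b c p :: "real \<Rightarrow> real \<Rightarrow> real \<Rightarrow> real"
    and U :: "real \<Rightarrow> real^3 \<Rightarrow> real^3" and P :: "real \<Rightarrow> real^3 \<Rightarrow> real"
    and U\<^sub>0 :: "real^3 \<Rightarrow> real^3"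
  assumes T_pos: "0 < T"
    and solution: "axisymmetric_euler_solution T a b c p U P U\<^sub>0"
begin

abbreviation "spacetime \<equiv> {0..<T} \<times> cylinder"

text \<open>\<open>Ck_on\<close> only asserts that derivatives exist. A choice fixes one whose
  components along basis vectors are again differentiable; the first argument is a spacetime point,
  the second a direction.\<close>

definition DU :: "real \<times> (real^3) \<Rightarrow> real \<times> (real^3) \<Rightarrow> real^3" where
  "DU = (SOME D. (\<forall>y\<in>spacetime. ((\<lambda>(t, x). U t x) has_derivative D y) (at y within spacetime)) \<and>
    (\<forall>v\<in>Basis. Ck_on 1 (\<lambda>y. D y v) spacetime))"

lemma DU_exists: "(\<forall>y\<in>spacetime. ((\<lambda>(t, x). U t x) has_derivative DU y) (at y within spacetime)) \<and>
    (\<forall>v\<in>Basis. Ck_on 1 (\<lambda>y. DU y v) spacetime)"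
proof -
  have "Ck_on (Suc 1) (\<lambda>(t, x). U t x) spacetime"
    using solution unfolding axisymmetric_euler_solution_def smooth_on_def by blast
  then have "\<exists>D. (\<forall>y\<in>spacetime. ((\<lambda>(t, x). U t x) has_derivative D y) (at y within spacetime)) \<and>
    (\<forall>v\<in>Basis. Ck_on 1 (\<lambda>y. D y v) spacetime)"
    by (simp only: Ck_on.simps)
  then show ?thesis
    unfolding DU_def by (rule someI_ex)
qed

lemma DU: "t \<in> {0..<T} \<Longrightarrow> x \<in> cylinder \<Longrightarrow>
    ((\<lambda>y. U (fst y) (snd y)) has_derivative DU (t, x)) (at (t, x) within spacetime)"
  using bspec[OF DU_exists[THEN conjunct1], of "(t, x)"] by (simp add: case_prod_beta')

text \<open>\<open>D2U v y w\<close> differentiates the partial derivative in direction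
  \<open>v\<close> once more, in direction \<open>w\<close>. Symmetry in \<open>v\<close> and
  \<open>w\<close> is not built in; the one instance used is proved at the origin.\<close>

definition D2U :: "real \<times> (real^3) \<Rightarrow> real \<times> (real^3) \<Rightarrow> real \<times> (real^3) \<Rightarrow> real^3" where
  "D2U v = (SOME D. (\<forall>y\<in>spacetime. ((\<lambda>y. DU y v) has_derivative D y) (at y within spacetime)) \<and>
    (\<forall>w\<in>Basis. continuous_on spacetime (\<lambda>y. D y w)))"

lemma D2U_exists:
  assumes "v \<in> Basis"
  shows "(\<forall>y\<in>spacetime. ((\<lambda>y. DU y v) has_derivative D2U v y) (at y within spacetime)) \<and>
    (\<forall>w\<in>Basis. continuous_on spacetime (\<lambda>y. D2U v y w))"
proof -
  have "Ck_on (Suc 0) (\<lambda>y. DU y v) spacetime"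
    using DU_exists assms by simp
  then have "\<exists>D. (\<forall>y\<in>spacetime. ((\<lambda>y. DU y v) has_derivative D y) (at y within spacetime)) \<and>
    (\<forall>w\<in>Basis. continuous_on spacetime (\<lambda>y. D y w))"
    by (simp only: Ck_on.simps)
  then show ?thesis
    unfolding D2U_def by (rule someI_ex)
qed

lemma D2U: "v \<in> Basis \<Longrightarrow> t \<in> {0..<T} \<Longrightarrow> x \<in> cylinder \<Longrightarrow>
    ((\<lambda>y. DU y v) has_derivative D2U v (t, x)) (at (t, x) within spacetime)"
  and cont_D2U: "v \<in> Basis \<Longrightarrow> w \<in> Basis \<Longrightarrow> continuous_on spacetime (\<lambda>y. D2U v y w)"
  using D2U_exists by auto

lemma cont_U: "continuous_on spacetime (\<lambda>y. U (fst y) (snd y))"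
  using DU by (intro has_derivative_continuous_on[where f' = DU]) auto

lemma cont_DU: "v \<in> Basis \<Longrightarrow> continuous_on spacetime (\<lambda>y. DU y v)"
  using D2U_exists by (intro has_derivative_continuous_on[where f' = "D2U v"]) blast

lemma U_along:
  assumes "t \<in> {0..<T}" "\<gamma> s \<in> cylinder" "(\<gamma> has_vector_derivative v) (at s within I)" "\<gamma> ` I \<subseteq> cylinder"
  shows "((\<lambda>s. U t (\<gamma> s)) has_vector_derivative DU (t, \<gamma> s) (0, v)) (at s within I)"
proof -
  have "(\<lambda>s. (t, \<gamma> s)) ` I \<subseteq> spacetime"
    using assms by blast
  from has_vector_derivative_along[OF DU[OF assms(1,2)] has_vector_derivative_Pair[OF has_vector_derivative_const assms(3)] this]
  show ?thesis by simp
qed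

lemma DU_along:
  assumes "w \<in> Basis" "t \<in> {0..<T}" "\<gamma> s \<in> cylinder" "(\<gamma> has_vector_derivative v) (at s within I)" "\<gamma> ` I \<subseteq> cylinder"
  shows "((\<lambda>s. DU (t, \<gamma> s) w) has_vector_derivative D2U w (t, \<gamma> s) (0, v)) (at s within I)"
proof -
  have "(\<lambda>s. (t, \<gamma> s)) ` I \<subseteq> spacetime"
    using assms by blast
  from has_vector_derivative_along[OF D2U[OF assms(1-3)] has_vector_derivative_Pair[OF has_vector_derivative_const assms(4)] this]
  show ?thesis by simp
qed

lemma U_deriv_t:
  assumes "t \<in> {0..<T}" "x \<in> cylinder"
  shows "((\<lambda>t. U t x) has_vector_derivative DU (t, x) (1, 0)) (at t within {0..<T})"
  using has_vector_derivative_along[OF DU[OF assms] has_vector_derivative_Pair[OF has_vector_derivative_id has_vector_derivative_const]] assms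
  by auto

lemma DU_deriv_t:
  assumes "w \<in> Basis" "t \<in> {0..<T}" "x \<in> cylinder"
  shows "((\<lambda>t. DU (t, x) w) has_vector_derivative D2U w (t, x) (1, 0)) (at t within {0..<T})"
  using has_vector_derivative_along[OF D2U[OF assms] has_vector_derivative_Pair[OF has_vector_derivative_id has_vector_derivative_const]] assms
  by auto

lemma U_deriv_x:
  assumes "t \<in> {0..<T}" "x \<in> cylinder"
  shows "(U t has_derivative (\<lambda>h. DU (t, x) (0, h))) (at x within cylinder)"
proof -
  have "((\<lambda>x. (t, x)) has_derivative (\<lambda>h. (0, h))) (at x within cylinder)"
    by (auto intro!: derivative_eq_intros)
  moreover have "Pair t ` cylinder \<subseteq> spacetime"
    using assms by blast
  ultimately show ?thesis
    using has_derivative_in_compose[of "Pair t" "\<lambda>h. (0, h)" x cylinder "\<lambda>y. U (fst y) (snd y)" "DU (t, x)"]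
      has_derivative_subset[OF DU[OF assms]] by simp
qed

lemma jac_eq: "t \<in> {0..<T} \<Longrightarrow> x \<in> cylinder \<Longrightarrow> jac (U t) x $ i $ j = DU (t, x) (0, axis j 1) $ i"
  by (simp add: jac_def jacobian_def frechet_derivative_cylinder[OF _ U_deriv_x] matrix_def)

lemma DU_space_expand:
  assumes "t \<in> {0..<T}" "x \<in> cylinder"
  shows "DU (t, x) (0, h) = h $ 1 *\<^sub>R DU (t, x) (0, axis 1 1) + h $ 2 *\<^sub>R DU (t, x) (0, axis 2 1)
    + h $ 3 *\<^sub>R DU (t, x) (0, axis 3 1)"
proof -
  note lin = has_derivative_linear[OF U_deriv_x[OF assms]]
  show ?thesis
    by (subst vec3_expand[of h]) (simp only: linear_add[OF lin] linear_scale[OF lin])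
qed

lemma time_derivative:
  assumes "t \<in> {0..<T}" "x \<in> cylinder"
  shows "vector_derivative (\<lambda>s. U s x) (at t within {0..<T}) = DU (t, x) (1, 0)"
  using assms by (intro vector_derivative_within U_deriv_t) (auto simp: trivial_limit_within)

lemma momentum:
  assumes "t \<in> {0..<T}" "x \<in> cylinder"
  shows "DU (t, x) (1, 0) + U t x $ 1 *\<^sub>R DU (t, x) (0, axis 1 1) + U t x $ 2 *\<^sub>R DU (t, x) (0, axis 2 1)
    + U t x $ 3 *\<^sub>R DU (t, x) (0, axis 3 1) = - grad (P t) x"
proof -
  have "advect (U t) (U t) x = U t x $ 1 *\<^sub>R DU (t, x) (0, axis 1 1) + U t x $ 2 *\<^sub>R DU (t, x) (0, axis 2 1)
    + U t x $ 3 *\<^sub>R DU (t, x) (0, axis 3 1)"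
    by (simp add: vec_eq_iff advect_def matrix_vector_mult_def sum_3 jac_eq[OF assms] mult.commute)
  moreover have "vector_derivative (\<lambda>s. U s x) (at t within {0..<T}) + advect (U t) (U t) x = - grad (P t) x"
    using solution assms unfolding axisymmetric_euler_solution_def by blast
  ultimately show ?thesis
    unfolding time_derivative[OF assms] by (simp only: add.assoc)
qed

lemma divergence_free:
  assumes "t \<in> {0..<T}" "x \<in> cylinder"
  shows "DU (t, x) (0, axis 1 1) $ 1 + DU (t, x) (0, axis 2 1) $ 2 + DU (t, x) (0, axis 3 1) $ 3 = 0"
proof -
  have "divergence (U t) x = 0"
    using solution assms by (auto simp: axisymmetric_euler_solution_def)
  then show ?thesis
    by (simp add: divergence_def trace_def sum_3 jac_eq[OF assms])
qed

lemma P_C2: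
  assumes "t \<in> {0..<T}"
  obtains D D2 where
    "\<And>x. x \<in> cylinder \<Longrightarrow> (P t has_derivative D x) (at x within cylinder)"
    "\<And>x i. x \<in> cylinder \<Longrightarrow> ((\<lambda>x. D x (axis i 1)) has_derivative D2 i x) (at x within cylinder)"
proof -
  have "Ck_on (Suc (Suc 0)) (P t) cylinder"
    using solution assms unfolding axisymmetric_euler_solution_def smooth_on_def by blast
  then obtain D where D: "\<And>x. x \<in> cylinder \<Longrightarrow> (P t has_derivative D x) (at x within cylinder)"
    "\<And>v. v \<in> Basis \<Longrightarrow> \<exists>D2. (\<forall>x\<in>cylinder. ((\<lambda>x. D x v) has_derivative D2 x) (at x within cylinder))"
    unfolding Ck_on.simps by blast
  have "\<exists>D2. \<forall>x\<in>cylinder. ((\<lambda>x. D x (axis i 1)) has_derivative D2 x) (at x within cylinder)" for i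
    using D(2)[of "axis i 1"] by (simp add: axis_in_Basis_iff)
  then obtain D2 where "\<And>i. \<forall>x\<in>cylinder. ((\<lambda>x. D x (axis i 1)) has_derivative D2 i x) (at x within cylinder)"
    by metis
  with D(1) show ?thesis
    by (intro that[of D D2]) auto
qed

lemma P_deriv:
  assumes "t \<in> {0..<T}" "x \<in> cylinder"
  shows "(P t has_derivative (\<lambda>h. grad (P t) x \<bullet> h)) (at x within cylinder)"
proof -
  obtain D D2 where D: "\<And>x. x \<in> cylinder \<Longrightarrow> (P t has_derivative D x) (at x within cylinder)"
    using P_C2[OF assms(1)] by metis
  note lin = has_derivative_linear[OF D[OF assms(2)]]
  have "D x h = grad (P t) x \<bullet> h" for h
    by (subst vec3_expand[of h], simp only: linear_add[OF lin] linear_scale[OF lin])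
      (simp add: grad_def frechet_derivative_cylinder[OF assms(2) D[OF assms(2)]] inner_vec_def sum_3)
  then show ?thesis
    using D[OF assms(2)] by (metis (no_types, lifting) ext)
qed

lemma grad_differentiable:
  assumes "t \<in> {0..<T}"
  obtains D2 where "\<And>x i. x \<in> cylinder \<Longrightarrow> ((\<lambda>x. grad (P t) x $ i) has_derivative D2 i x) (at x within cylinder)"
proof -
  obtain D D2 where D: "\<And>x. x \<in> cylinder \<Longrightarrow> (P t has_derivative D x) (at x within cylinder)"
    and D2: "\<And>x i. x \<in> cylinder \<Longrightarrow> ((\<lambda>x. D x (axis i 1)) has_derivative D2 i x) (at x within cylinder)"
    using P_C2[OF assms(1)] by metis
  have "grad (P t) x $ i = D x (axis i 1)" if "x \<in> cylinder" for x i
    by (simp add: grad_def frechet_derivative_cylinder[OF that D[OF that]])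
  then have "((\<lambda>x. grad (P t) x $ i) has_derivative D2 i x) (at x within cylinder)" if "x \<in> cylinder" for x i
    using has_derivative_transform[OF that, of "\<lambda>x. grad (P t) x $ i" "\<lambda>x. D x (axis i 1)"] D2[OF that] that
    by blast
  then show ?thesis by (rule that)
qed

lemma profile:
  assumes "t \<in> {0..<T}" "r \<in> {0..1}"
  shows "U t (cyl r \<theta> z) = a t r z *\<^sub>R e_r \<theta> + b t r z *\<^sub>R e_theta \<theta> + c t r z *\<^sub>R e_z"
  using solution assms by (auto simp: axisymmetric_euler_solution_def axisymmetric_field_def)

lemma profile_0:
  assumes "t \<in> {0..<T}" "r \<in> {0..1}"
  shows "U t (cyl r 0 z) $ 1 = a t r z" "U t (cyl r 0 z) $ 2 = b t r z" "U t (cyl r 0 z) $ 3 = c t r z"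
  by (simp_all add: profile[OF assms])

lemma pressure_profile: "t \<in> {0..<T} \<Longrightarrow> r \<in> {0..1} \<Longrightarrow> P t (cyl r \<theta> z) = p t r z"
  using solution by (auto simp: axisymmetric_euler_solution_def axisymmetric_scalar_def)

text \<open>The velocity on a circle is differentiated in the angle in two ways: by the chain rule,
  and through the rotating frame with profiles that do not depend on the angle. The identity also
  covers r = 0, where it forces the horizontal velocity to vanish.\<close>

lemma swirl:
  assumes "t \<in> {0..<T}" "r \<in> {0..1}"
  shows "r *\<^sub>R DU (t, cyl r 0 z) (0, axis 2 1) = vector [- (U t (cyl r 0 z) $ 2), U t (cyl r 0 z) $ 1, 0]"
proof -
  have "((\<lambda>\<theta>. U t (cyl r \<theta> z)) has_vector_derivative DU (t, cyl r 0 z) (0, r *\<^sub>R e_theta 0)) (at 0)"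
    using assms cyl_in_cylinder by (intro U_along cyl_deriv_theta) auto
  moreover have "((\<lambda>\<theta>. U t (cyl r \<theta> z)) has_vector_derivative a t r z *\<^sub>R e_theta 0 - b t r z *\<^sub>R e_r 0) (at 0)"
    unfolding profile[OF assms] by (auto intro!: derivative_eq_intros e_r_deriv e_theta_deriv)
  ultimately have "DU (t, cyl r 0 z) (0, r *\<^sub>R e_theta 0) = a t r z *\<^sub>R e_theta 0 - b t r z *\<^sub>R e_r 0"
    by (rule vector_derivative_unique_at)
  moreover have "DU (t, cyl r 0 z) (0, r *\<^sub>R e_theta 0) = r *\<^sub>R DU (t, cyl r 0 z) (0, axis 2 1)"
    using linear_scale[OF has_derivative_linear[OF U_deriv_x]] assms cyl_in_cylinder by (simp add: e_at_0)
  ultimately show ?thesis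
    by (simp add: profile_0[OF assms] vec_eq_iff forall_3)
qed

lemma grad_theta:
  assumes "t \<in> {0..<T}" "r \<in> {0..1}"
  shows "r * grad (P t) (cyl r 0 z) $ 2 = 0"
proof -
  have "((\<lambda>\<theta>. P t (cyl r \<theta> z)) has_vector_derivative grad (P t) (cyl r 0 z) \<bullet> (r *\<^sub>R e_theta 0)) (at 0)"
    using assms cyl_in_cylinder by (intro has_vector_derivative_along[OF P_deriv] cyl_deriv_theta) auto
  moreover have "((\<lambda>\<theta>. P t (cyl r \<theta> z)) has_vector_derivative 0) (at 0)"
    unfolding pressure_profile[OF assms] by (rule has_vector_derivative_const)
  ultimately have "grad (P t) (cyl r 0 z) \<bullet> (r *\<^sub>R e_theta 0) = 0"
    by (rule vector_derivative_unique_at)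
  then show ?thesis
    by (simp add: e_at_0 inner_axis)
qed

end

text \<open>Existence of the derivative in the order s, then t, with continuity, yields the other
  order: \<open>f t \<sigma> - f t 0\<close> is the integral of \<open>fs t\<close>, and
  differentiation under the integral sign shows that \<open>ft t\<close> is a primitive of
  \<open>fst' t\<close>.\<close>

lemma has_vector_derivative_mixed:
  fixes f :: "real \<Rightarrow> real \<Rightarrow> 'a::banach"
  assumes I: "convex I" "\<And>t. t \<in> I \<Longrightarrow> at t within I \<noteq> bot"
    and fs: "\<And>t s. t \<in> I \<Longrightarrow> s \<in> {0..1} \<Longrightarrow> (f t has_vector_derivative fs t s) (at s within {0..1})"
    and ft: "\<And>t s. t \<in> I \<Longrightarrow> s \<in> {0..1} \<Longrightarrow> ((\<lambda>t. f t s) has_vector_derivative ft t s) (at t within I)"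
    and fst': "\<And>t s. t \<in> I \<Longrightarrow> s \<in> {0..1} \<Longrightarrow> ((\<lambda>t. fs t s) has_vector_derivative fst' t s) (at t within I)"
    and cont: "continuous_on (I \<times> {0..1}) (\<lambda>(t, s). fst' t s)"
    and t: "t \<in> I" and s: "s \<in> {0..1}"
  shows "(ft t has_vector_derivative fst' t s) (at s within {0..1})"
proof -
  have int: "(fs t has_integral f t \<sigma> - f t 0) {0..\<sigma>}" if "t \<in> I" "\<sigma> \<in> {0..1}" for t \<sigma>
    using that by (intro fundamental_theorem_of_calculus has_vector_derivative_within_subset[OF fs]) auto
  have eq: "ft t \<sigma> = ft t 0 + integral {0..\<sigma>} (fst' t)" if \<sigma>: "\<sigma> \<in> {0..1}" for \<sigma>
  proof -
    have "((\<lambda>t. integral (cbox 0 \<sigma>) (fs t)) has_vector_derivative integral (cbox 0 \<sigma>) (fst' t)) (at t within I)"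
    proof (rule leibniz_rule_vector_derivative)
      show "continuous_on (I \<times> cbox 0 \<sigma>) (\<lambda>(t, s). fst' t s)"
        using \<sigma> by (intro continuous_on_subset[OF cont]) auto
    qed (use \<sigma> I t int fst' in \<open>auto intro: has_integral_integrable\<close>)
    then have "((\<lambda>t. f t \<sigma> - f t 0) has_vector_derivative integral (cbox 0 \<sigma>) (fst' t)) (at t within I)"
      by (rule has_vector_derivative_transform[OF t, rotated]) (use integral_unique[OF int] \<sigma> in simp)
    moreover have "((\<lambda>t. f t \<sigma> - f t 0) has_vector_derivative ft t \<sigma> - ft t 0) (at t within I)"
      using \<sigma> t by (intro has_vector_derivative_diff ft) auto
    ultimately have "integral {0..\<sigma>} (fst' t) = ft t \<sigma> - ft t 0"
      using vector_derivative_unique_within[OF I(2)[OF t]] by (simp only: cbox_interval) blast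
    then show ?thesis by simp
  qed
  have "continuous_on {0..1} (fst' t)"
    using continuous_on_compose2[OF cont, of "{0..1}" "Pair t"] t by (auto simp: continuous_on_Pair)
  from integral_has_vector_derivative[OF this s]
  have "((\<lambda>\<sigma>. ft t 0 + integral {0..\<sigma>} (fst' t)) has_vector_derivative fst' t s) (at s within {0..1})"
    by (auto intro!: derivative_eq_intros)
  then show ?thesis
    by (rule has_vector_derivative_transform[OF s, rotated]) (rule eq)
qed

section \<open>The solution on the half-plane and radial derivatives at the origin\<close>

context euler_flow
begin

lemma U_deriv_r:
  assumes "t \<in> {0..<T}" "r \<in> {0..1}"
  shows "((\<lambda>r. U t (cyl r \<theta> z)) has_vector_derivative DU (t, cyl r \<theta> z) (0, e_r \<theta>)) (at r within {0..1})"
  by (rule U_along[where \<gamma> = "\<lambda>r. cyl r \<theta> z"]) (use assms cyl_in_cylinder cyl_deriv_r in auto)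

lemma U_deriv_z:
  assumes "t \<in> {0..<T}" "r \<in> {0..1}"
  shows "((\<lambda>z. U t (cyl r \<theta> z)) has_vector_derivative DU (t, cyl r \<theta> z) (0, e_z)) (at z within I)"
  by (rule U_along[where \<gamma> = "\<lambda>z. cyl r \<theta> z"]) (use assms cyl_in_cylinder cyl_deriv_z in auto)

lemma DU_deriv_r:
  assumes "w \<in> Basis" "t \<in> {0..<T}" "r \<in> {0..1}"
  shows "((\<lambda>r. DU (t, cyl r \<theta> z) w) has_vector_derivative D2U w (t, cyl r \<theta> z) (0, e_r \<theta>)) (at r within {0..1})"
  by (rule DU_along[where \<gamma> = "\<lambda>r. cyl r \<theta> z"]) (use assms cyl_in_cylinder cyl_deriv_r in auto)

lemma P_deriv_r:
  assumes "t \<in> {0..<T}" "r \<in> {0..1}"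
  shows "((\<lambda>r. P t (cyl r 0 z)) has_real_derivative grad (P t) (cyl r 0 z) $ 1) (at r within {0..1})"
proof -
  have "((\<lambda>r. P t (cyl r 0 z)) has_vector_derivative grad (P t) (cyl r 0 z) \<bullet> e_r 0) (at r within {0..1})"
    by (rule has_vector_derivative_along[where \<gamma> = "\<lambda>r. cyl r 0 z", OF P_deriv])
      (use assms cyl_in_cylinder cyl_deriv_r in auto)
  then show ?thesis
    by (simp add: e_at_0 inner_axis has_real_derivative_iff_has_vector_derivative)
qed

lemma P_deriv_z:
  assumes "t \<in> {0..<T}" "r \<in> {0..1}"
  shows "((\<lambda>z. P t (cyl r 0 z)) has_real_derivative grad (P t) (cyl r 0 z) $ 3) (at z within I)"
proof -
  have "((\<lambda>z. P t (cyl r 0 z)) has_vector_derivative grad (P t) (cyl r 0 z) \<bullet> e_z) (at z within I)"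
    by (rule has_vector_derivative_along[where \<gamma> = "\<lambda>z. cyl r 0 z", OF P_deriv])
      (use assms cyl_in_cylinder cyl_deriv_z in auto)
  then show ?thesis
    by (simp add: e_at_0 inner_axis has_real_derivative_iff_has_vector_derivative)
qed

lemma grad_deriv_r:
  assumes "t \<in> {0..<T}"
  obtains d where "\<And>r. r \<in> {0..1} \<Longrightarrow>
    ((\<lambda>r. grad (P t) (cyl r \<theta> z) $ i) has_vector_derivative d r) (at r within {0..1})"
proof -
  obtain D2 where D2: "\<And>x i. x \<in> cylinder \<Longrightarrow> ((\<lambda>x. grad (P t) x $ i) has_derivative D2 i x) (at x within cylinder)"
    using grad_differentiable[OF assms] by blast
  have "((\<lambda>r. grad (P t) (cyl r \<theta> z) $ i) has_vector_derivative D2 i (cyl r \<theta> z) (e_r \<theta>)) (at r within {0..1})"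
    if "r \<in> {0..1}" for r
    by (rule has_vector_derivative_along[where \<gamma> = "\<lambda>r. cyl r \<theta> z", OF D2])
      (use that cyl_in_cylinder cyl_deriv_r in auto)
  then show ?thesis by (rule that)
qed

text \<open>On the half-plane \<theta> = 0 the moving frame is the Cartesian one, so the Cartesian
  components and derivatives serve as the radial, azimuthal and axial ones.\<close>

lemma meridional_flow:
  assumes "\<tau> < T"
  shows "meridional_euler \<tau> (\<lambda>t x. U t (cyl (fst x) 0 (snd x)))
    (\<lambda>t x. DU (t, cyl (fst x) 0 (snd x)) (1, 0)) (\<lambda>t x. DU (t, cyl (fst x) 0 (snd x)) (0, axis 1 1))
    (\<lambda>t x. DU (t, cyl (fst x) 0 (snd x)) (0, axis 2 1)) (\<lambda>t x. DU (t, cyl (fst x) 0 (snd x)) (0, axis 3 1))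
    (\<lambda>t x. P t (cyl (fst x) 0 (snd x)))
    (\<lambda>t x. grad (P t) (cyl (fst x) 0 (snd x)) $ 1) (\<lambda>t x. grad (P t) (cyl (fst x) 0 (snd x)) $ 3)"
proof
  have cyl_cont: "continuous_on X (\<lambda>y. cyl (f y) 0 (g y))"
    if "continuous_on X f" "continuous_on X g" for X :: "'z::topological_space set" and f g
  proof -
    have "cyl (f y) 0 (g y) = f y *\<^sub>R e_r 0 + g y *\<^sub>R e_z" for y
      by (auto simp: vec_eq_iff forall_3)
    then show ?thesis
      using that by (auto intro!: continuous_intros)
  qed
  have image: "(\<lambda>x. cyl (fst x) 0 (snd x)) ` meridian \<subseteq> cylinder"
    using cyl_in_cylinder by (auto simp: atLeastAtMost_iff)
  have cont: "continuous_on ({0..\<tau>} \<times> meridian) (\<lambda>(t, x). f (t, cyl (fst x) 0 (snd x)))"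
    if "continuous_on spacetime f" for f :: "real \<times> (real^3) \<Rightarrow> real^3"
    unfolding split_beta
  proof (rule continuous_on_compose2[OF that])
    show "continuous_on ({0..\<tau>} \<times> meridian) (\<lambda>x. (fst x, cyl (fst (snd x)) 0 (snd (snd x))))"
      by (intro continuous_intros cyl_cont)
    show "(\<lambda>x. (fst x, cyl (fst (snd x)) 0 (snd (snd x)))) ` ({0..\<tau>} \<times> meridian) \<subseteq> spacetime"
      using assms by (auto intro!: cyl_in_cylinder)
  qed
  show "continuous_on ({0..\<tau>} \<times> meridian) (\<lambda>(t, x). U t (cyl (fst x) 0 (snd x)))"
    using cont[OF cont_U] by simp
  show "continuous_on ({0..\<tau>} \<times> meridian) (\<lambda>(t, x). DU (t, cyl (fst x) 0 (snd x)) (1, 0))"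
    "continuous_on ({0..\<tau>} \<times> meridian) (\<lambda>(t, x). DU (t, cyl (fst x) 0 (snd x)) (0, axis 1 1))"
    "continuous_on ({0..\<tau>} \<times> meridian) (\<lambda>(t, x). DU (t, cyl (fst x) 0 (snd x)) (0, axis 2 1))"
    "continuous_on ({0..\<tau>} \<times> meridian) (\<lambda>(t, x). DU (t, cyl (fst x) 0 (snd x)) (0, axis 3 1))"
    using cont[OF cont_DU[OF Basis_spacetime(1)]] cont[OF cont_DU[OF Basis_spacetime(2)]] by simp_all
  fix t assume "t \<in> {0..\<tau>}"
  then have t: "t \<in> {0..<T}"
    using assms by auto
  have cont: "continuous_on meridian (\<lambda>x. f (cyl (fst x) 0 (snd x)))"
    if "continuous_on cylinder f" for f :: "real^3 \<Rightarrow> real"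
    by (rule continuous_on_compose2[OF that _ image]) (intro cyl_cont continuous_intros)
  have "continuous_on cylinder (P t)"
    using P_deriv[OF t] by (rule has_derivative_continuous_on)
  then show "continuous_on meridian (\<lambda>x. P t (cyl (fst x) 0 (snd x)))"
    by (rule cont)
  obtain D2 where "\<And>x i. x \<in> cylinder \<Longrightarrow> ((\<lambda>x. grad (P t) x $ i) has_derivative D2 i x) (at x within cylinder)"
    using grad_differentiable[OF t] by blast
  then have "continuous_on cylinder (\<lambda>x. grad (P t) x $ i)" for i
    by (rule has_derivative_continuous_on)
  then show "continuous_on meridian (\<lambda>x. grad (P t) (cyl (fst x) 0 (snd x)) $ 1)"
    "continuous_on meridian (\<lambda>x. grad (P t) (cyl (fst x) 0 (snd x)) $ 3)"
    using cont[of "\<lambda>x. grad (P t) x $ 1"] cont[of "\<lambda>x. grad (P t) x $ 3"] by simp_all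
  show "((\<lambda>t. U t (cyl (fst x) 0 (snd x))) has_vector_derivative DU (t, cyl (fst x) 0 (snd x)) (1, 0)) (at t within {0..\<tau>})"
    if "x \<in> meridian" for x
    using t image that assms by (intro has_vector_derivative_within_subset[OF U_deriv_t]) auto
  fix r :: real assume r: "r \<in> {0..1}"
  have "cyl r 0 pi = cyl r 0 (- pi) + axis 3 (2 * pi)"
    by (simp add: vec_eq_iff forall_3) (simp add: axis_def)
  moreover have "z_periodic (U t)" "z_periodic (P t)"
    using solution t by (auto simp: axisymmetric_euler_solution_def)
  ultimately show "U t (cyl (fst (r, pi)) 0 (snd (r, pi))) = U t (cyl (fst (r, - pi)) 0 (snd (r, - pi)))"
    "P t (cyl (fst (r, pi)) 0 (snd (r, pi))) = P t (cyl (fst (r, - pi)) 0 (snd (r, - pi)))"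
    using cyl_in_cylinder[OF r] by (simp_all add: z_periodic_def)
  fix z :: real
  have x: "cyl r 0 z \<in> cylinder"
    using r by (rule cyl_in_cylinder)
  show "((\<lambda>r. U t (cyl (fst (r, z)) 0 (snd (r, z)))) has_vector_derivative
      DU (t, cyl (fst (r, z)) 0 (snd (r, z))) (0, axis 1 1)) (at r within {0..1})"
    using U_deriv_r[OF t r, of 0 z] by (simp add: e_at_0)
  show "((\<lambda>z. U t (cyl (fst (r, z)) 0 (snd (r, z)))) has_vector_derivative
      DU (t, cyl (fst (r, z)) 0 (snd (r, z))) (0, axis 3 1)) (at z within {- pi..pi})"
    using U_deriv_z[OF t r, of 0 z] by (simp add: e_at_0)
  show "((\<lambda>r. P t (cyl (fst (r, z)) 0 (snd (r, z)))) has_real_derivative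
      grad (P t) (cyl (fst (r, z)) 0 (snd (r, z))) $ 1) (at r within {0..1})"
    using P_deriv_r[OF t r] by simp
  show "((\<lambda>z. P t (cyl (fst (r, z)) 0 (snd (r, z)))) has_real_derivative
      grad (P t) (cyl (fst (r, z)) 0 (snd (r, z))) $ 3) (at z within {- pi..pi})"
    using P_deriv_z[OF t r] by simp
  \<comment> \<open>\<open>grad_theta\<close> annihilates the azimuthal pressure gradient with the
    factor r in front, matching the weight in the momentum equation.\<close>
  have "r *\<^sub>R (- grad (P t) (cyl r 0 z))
      = - (r *\<^sub>R vector [grad (P t) (cyl r 0 z) $ 1, 0, grad (P t) (cyl r 0 z) $ 3])"
    using grad_theta[OF t r] by (auto simp: vec_eq_iff forall_3)
  then show "r *\<^sub>R (DU (t, cyl (fst (r, z)) 0 (snd (r, z))) (1, 0)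
      + U t (cyl (fst (r, z)) 0 (snd (r, z))) $ 1 *\<^sub>R DU (t, cyl (fst (r, z)) 0 (snd (r, z))) (0, axis 1 1)
      + U t (cyl (fst (r, z)) 0 (snd (r, z))) $ 2 *\<^sub>R DU (t, cyl (fst (r, z)) 0 (snd (r, z))) (0, axis 2 1)
      + U t (cyl (fst (r, z)) 0 (snd (r, z))) $ 3 *\<^sub>R DU (t, cyl (fst (r, z)) 0 (snd (r, z))) (0, axis 3 1))
      = - (r *\<^sub>R vector [grad (P t) (cyl (fst (r, z)) 0 (snd (r, z))) $ 1, 0, grad (P t) (cyl (fst (r, z)) 0 (snd (r, z))) $ 3])"
    using momentum[OF t x] by (simp only: fst_conv snd_conv)
  show "DU (t, cyl (fst (r, z)) 0 (snd (r, z))) (0, axis 1 1) $ 1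
      + DU (t, cyl (fst (r, z)) 0 (snd (r, z))) (0, axis 2 1) $ 2
      + DU (t, cyl (fst (r, z)) 0 (snd (r, z))) (0, axis 3 1) $ 3 = 0"
    using divergence_free[OF t x] by simp
  show "r *\<^sub>R DU (t, cyl (fst (r, z)) 0 (snd (r, z))) (0, axis 2 1)
      = vector [- (U t (cyl (fst (r, z)) 0 (snd (r, z))) $ 2), U t (cyl (fst (r, z)) 0 (snd (r, z))) $ 1, 0]"
    using swirl[OF t r] by simp
next
  fix t z assume "t \<in> {0..\<tau>}"
  then have "t \<in> {0..<T}" using assms by simp
  then show "U t (cyl (fst (1, z)) 0 (snd (1, z))) $ 1 = 0"
    using solution profile_0(1)[of t 1 z] by (simp add: axisymmetric_euler_solution_def)
qed

lemma U_axis: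
  assumes "t \<in> {0..<T}"
  shows "U t (cyl 0 0 z) $ 1 = 0" "U t (cyl 0 0 z) $ 2 = 0"
  using swirl[OF assms, of 0 z] by (auto simp: vec_eq_iff forall_3)

text \<open>The identity r times the azimuthal gradient = 0 determines the gradient only for r > 0;
  continuity supplies the value at r = 0, and the function differentiated is then zero on the whole
  radius.\<close>

lemma grad_origin_2:
  assumes "t \<in> {0..<T}"
  shows "((\<lambda>s. grad (P t) (cyl s 0 0) $ 2) has_vector_derivative 0) (at 0 within {0..1})"
proof -
  obtain d where d: "\<And>s. s \<in> {0..1} \<Longrightarrow>
      ((\<lambda>s. grad (P t) (cyl s 0 0) $ 2) has_vector_derivative d s) (at s within {0..1})"
    using grad_deriv_r[OF assms] by blast
  have "continuous_on {0..1} (\<lambda>s. grad (P t) (cyl s 0 0) $ 2)"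
    using d by (rule continuous_on_vector_derivative)
  moreover have "grad (P t) (cyl s 0 0) $ 2 = 0" if "s \<in> {0<..<1}" for s
    using grad_theta[OF assms, of s 0] that by simp
  ultimately have "grad (P t) (cyl s 0 0) $ 2 = 0" if "s \<in> {0..1}" for s
    using continuous_constant_on_closure[of "{0<..<1}" "\<lambda>s. grad (P t) (cyl s 0 0) $ 2" 0 s] that
    by (simp add: closure_greaterThanLessThan)
  then show ?thesis
    using has_vector_derivative_transform[of 0 "{0..1}" "\<lambda>s. grad (P t) (cyl s 0 0) $ 2" "\<lambda>s. 0" 0] by simp
qed

text \<open>Links the one-sided iterated derivative \<open>d_rr\<close> of the profile to the
  gradient occurring in the momentum equation.\<close>

lemma d_rr_pressure:
  assumes "t \<in> {0..<T}"
  shows "((\<lambda>s. grad (P t) (cyl s 0 0) $ 1) has_vector_derivative d_rr (p t) 0 0) (at 0 within {0..1})"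
proof -
  obtain d where d: "\<And>s. s \<in> {0..1} \<Longrightarrow>
      ((\<lambda>s. grad (P t) (cyl s 0 0) $ 1) has_vector_derivative d s) (at s within {0..1})"
    using grad_deriv_r[OF assms] by blast
  have nontrivial: "at s within {0..1} \<noteq> bot" if "s \<in> {0..1}" for s :: real
    using that by (simp add: trivial_limit_within islimpt_Icc)
  have inner: "vector_derivative (\<lambda>\<rho>. p t \<rho> 0) (at s within {0..1}) = grad (P t) (cyl s 0 0) $ 1"
    if s: "s \<in> {0..1}" for s
  proof (rule vector_derivative_within[OF nontrivial[OF s]])
    have "((\<lambda>\<rho>. P t (cyl \<rho> 0 0)) has_vector_derivative grad (P t) (cyl s 0 0) $ 1) (at s within {0..1})"
      using P_deriv_r[OF assms s] by (simp add: has_real_derivative_iff_has_vector_derivative)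
    then show "((\<lambda>\<rho>. p t \<rho> 0) has_vector_derivative grad (P t) (cyl s 0 0) $ 1) (at s within {0..1})"
      by (rule has_vector_derivative_transform[OF s, rotated]) (simp add: pressure_profile[OF assms])
  qed
  have "d_rr (p t) 0 0 = d 0"
    unfolding d_rr_def
  proof (rule vector_derivative_within[OF nontrivial])
    show "((\<lambda>s. vector_derivative (\<lambda>\<rho>. p t \<rho> 0) (at s within {0..1})) has_vector_derivative d 0) (at 0 within {0..1})"
      using has_vector_derivative_transform[of 0 "{0..1}", OF _ inner d] by simp
  qed simp
  then show ?thesis
    using d[of 0] by simp
qed

text \<open>The evolution of the velocity gradient needs the time derivative of its first column,
  whereas differentiating the momentum equation along a radius produces the radial derivative of the
  acceleration.\<close>

lemma D2U_origin_commute: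
  assumes "t \<in> {0..<T}"
  shows "D2U (0, axis 1 1) (t, 0) (1, 0) = D2U (1, 0) (t, 0) (0, axis 1 1)"
proof -
  have cyls: "cyl s 0 0 \<in> cylinder" if "s \<in> {0..1}" for s
    using that by (rule cyl_in_cylinder)
  have "((\<lambda>s. DU (t, cyl s 0 0) (1, 0)) has_vector_derivative D2U (0, axis 1 1) (t, cyl 0 0 0) (1, 0)) (at 0 within {0..1})"
  proof (rule has_vector_derivative_mixed[where I = "{0..<T}" and f = "\<lambda>t s. U t (cyl s 0 0)" and fs = "\<lambda>t s. DU (t, cyl s 0 0) (0, axis 1 1)"
        and fst' = "\<lambda>t s. D2U (0, axis 1 1) (t, cyl s 0 0) (1, 0)"])
    fix t s :: real assume t: "t \<in> {0..<T}" and s: "s \<in> {0..1}"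
    show "((\<lambda>s. U t (cyl s 0 0)) has_vector_derivative DU (t, cyl s 0 0) (0, axis 1 1)) (at s within {0..1})"
      using U_deriv_r[OF t s, of 0 0] by (simp add: e_at_0)
    show "((\<lambda>t. U t (cyl s 0 0)) has_vector_derivative DU (t, cyl s 0 0) (1, 0)) (at t within {0..<T})"
      by (intro U_deriv_t t cyls s)
    show "((\<lambda>t. DU (t, cyl s 0 0) (0, axis 1 1)) has_vector_derivative D2U (0, axis 1 1) (t, cyl s 0 0) (1, 0)) (at t within {0..<T})"
      by (intro DU_deriv_t Basis_spacetime t cyls s)
  next
    show "continuous_on ({0..<T} \<times> {0..1}) (\<lambda>(t, s). D2U (0, axis 1 1) (t, cyl s 0 0) (1, 0))"
      unfolding split_beta
    proof (rule continuous_on_compose2[OF cont_D2U[OF Basis_spacetime(2,1)]])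
      have "cyl s 0 0 = s *\<^sub>R e_r 0" for s
        by (auto simp: vec_eq_iff forall_3)
      then show "continuous_on ({0..<T} \<times> {0..1}) (\<lambda>x. (fst x, cyl (snd x) 0 0))"
        by (auto intro!: continuous_intros)
      show "(\<lambda>x. (fst x, cyl (snd x) 0 0)) ` ({0..<T} \<times> {0..1}) \<subseteq> spacetime"
        using cyls by auto
    qed
  qed (use assms in \<open>auto simp: trivial_limit_within\<close>)
  moreover have "((\<lambda>s. DU (t, cyl s 0 0) (1, 0)) has_vector_derivative D2U (1, 0) (t, cyl 0 0 0) (0, axis 1 1)) (at 0 within {0..1})"
    using DU_deriv_r[OF Basis_spacetime(1) assms, of 0 0 0] by (simp add: e_at_0)
  moreover have "at 0 within {0..1::real} \<noteq> bot"
    by (simp add: trivial_limit_within islimpt_Icc)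
  ultimately show ?thesis
    unfolding cyl_0_eq_0 by (blast dest: vector_derivative_unique_within)
qed

end

section \<open>Parity, the origin and blow-up\<close>

context euler_flow
begin

lemma U_origin:
  assumes init: "axisymmetric_field a\<^sub>0 b\<^sub>0 c\<^sub>0 U\<^sub>0"
    and parity: "odd_in_z c\<^sub>0" "even_in_z a\<^sub>0" "even_in_z b\<^sub>0"
    and t: "t \<in> {0..<T}"
  shows "U t 0 = 0"
proof -
  define u where "u t x = U t (cyl (fst x) 0 (snd x))" for t and x :: "real \<times> real"
  have "t < T" "0 \<le> t"
    using t by auto
  note flow = meridional_flow[OF \<open>t < T\<close>, folded u_def]
  interpret two_meridional_flows t u
    "\<lambda>t x. DU (t, cyl (fst x) 0 (snd x)) (1, 0)" "\<lambda>t x. DU (t, cyl (fst x) 0 (snd x)) (0, axis 1 1)"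
    "\<lambda>t x. DU (t, cyl (fst x) 0 (snd x)) (0, axis 2 1)" "\<lambda>t x. DU (t, cyl (fst x) 0 (snd x)) (0, axis 3 1)"
    "\<lambda>t x. P t (cyl (fst x) 0 (snd x))"
    "\<lambda>t x. grad (P t) (cyl (fst x) 0 (snd x)) $ 1" "\<lambda>t x. grad (P t) (cyl (fst x) 0 (snd x)) $ 3"
    "\<lambda>t x. flip (u t (mirror x))"
    "\<lambda>t x. flip (DU (t, cyl (fst (mirror x)) 0 (snd (mirror x))) (1, 0))"
    "\<lambda>t x. flip (DU (t, cyl (fst (mirror x)) 0 (snd (mirror x))) (0, axis 1 1))"
    "\<lambda>t x. flip (DU (t, cyl (fst (mirror x)) 0 (snd (mirror x))) (0, axis 2 1))"
    "\<lambda>t x. - flip (DU (t, cyl (fst (mirror x)) 0 (snd (mirror x))) (0, axis 3 1))"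
    "\<lambda>t x. P t (cyl (fst (mirror x)) 0 (snd (mirror x)))"
    "\<lambda>t x. grad (P t) (cyl (fst (mirror x)) 0 (snd (mirror x))) $ 1"
    "\<lambda>t x. - grad (P t) (cyl (fst (mirror x)) 0 (snd (mirror x))) $ 3"
  proof (intro two_meridional_flows.intro two_meridional_flows_axioms.intro)
    fix x :: "real \<times> real" assume "x \<in> meridian"
    then obtain r z where x: "x = (r, z)" and r: "r \<in> {0..1}" and z: "z \<in> {- pi..pi}"
      by (cases x) auto
    have "U 0 (cyl r 0 z) = a\<^sub>0 r z *\<^sub>R e_r 0 + b\<^sub>0 r z *\<^sub>R e_theta 0 + c\<^sub>0 r z *\<^sub>R e_z" for z
      using solution init r cyl_in_cylinder[OF r]
      by (simp add: axisymmetric_euler_solution_def axisymmetric_field_def)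
    then show "u 0 x = flip (u 0 (mirror x))"
      using parity r z by (simp add: u_def x mirror_def odd_in_z_def even_in_z_def vec_eq_iff forall_3)
  qed (use flow meridional_euler.reflect[OF flow] \<open>0 \<le> t\<close> in simp_all)
  \<comment> \<open>The mirror fixes points with z = 0 while \<open>flip\<close> negates the third
    component, which therefore equals its own negative. Uniqueness gives this off the axis; the axis
    is reached by continuity.\<close>
  have "U t (cyl r 0 0) $ 3 = 0" if "r \<in> {0<..<1}" for r
    using arg_cong[OF unique[of t "(r, 0)"], of "\<lambda>y. y $ 3"] that \<open>0 \<le> t\<close>
    by (simp add: u_def mirror_def)
  moreover have "continuous_on {0..1} (\<lambda>r. U t (cyl r 0 0) $ 3)"
    by (intro continuous_on_component continuous_on_vector_derivative[OF U_deriv_r[OF t]])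
  ultimately have "U t (cyl 0 0 0) $ 3 = 0"
    using continuous_constant_on_closure[of "{0<..<1}" "\<lambda>r. U t (cyl r 0 0) $ 3" 0 0]
    by (simp add: closure_greaterThanLessThan)
  then show ?thesis
    using U_axis[OF t, of 0] by (simp add: cyl_0_eq_0 vec_eq_iff forall_3)
qed

text \<open>The lifted cylinder is unbounded in z, so the derivatives are bounded by compactness
  only after intersecting with a ball; this intersection is convex, as the mean value inequality
  requires.\<close>

lemma U_lipschitz:
  assumes "\<tau> < T"
  obtains L where "\<And>t x. t \<in> {0..\<tau>} \<Longrightarrow> x \<in> cylinder \<Longrightarrow> norm x \<le> R \<Longrightarrow> norm (U t x - U t 0) \<le> L * norm x"
proof -
  define X where "X = cylinder \<inter> cball 0 R"
  have X: "compact X" "convex X"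
    unfolding X_def using closed_cylinder convex_cylinder by (auto intro: closed_Int_compact convex_Int)
  have "\<exists>B. \<forall>t\<in>{0..\<tau>}. \<forall>x\<in>X. norm (DU (t, x) (0, axis i 1)) \<le> B" for i
  proof -
    have "{0..\<tau>} \<times> X \<subseteq> spacetime"
      using assms by (auto simp: X_def)
    then have "bounded ((\<lambda>y. DU y (0, axis i 1)) ` ({0..\<tau>} \<times> X))"
      using X by (intro compact_imp_bounded compact_continuous_image compact_Times)
        (auto intro: continuous_on_subset[OF cont_DU] Basis_spacetime)
    then show ?thesis
      unfolding bounded_iff by auto
  qed
  then obtain B where B: "\<And>i t x. t \<in> {0..\<tau>} \<Longrightarrow> x \<in> X \<Longrightarrow> norm (DU (t, x) (0, axis i 1)) \<le> B i"
    by metis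
  have "norm (U t x - U t 0) \<le> (B 1 + B 2 + B 3) * norm (x - 0)"
    if t: "t \<in> {0..\<tau>}" and x: "x \<in> X" for t x
  proof (rule differentiable_bound[OF \<open>convex X\<close>])
    have t': "t \<in> {0..<T}"
      using t assms by auto
    show "0 \<in> X"
      using x order_trans[OF norm_ge_zero, of x R] by (auto simp: X_def zero_in_cylinder)
    fix y assume y: "y \<in> X"
    then have y': "y \<in> cylinder"
      by (simp add: X_def)
    show "(U t has_derivative (\<lambda>h. DU (t, y) (0, h))) (at y within X)"
      using has_derivative_subset[OF U_deriv_x[OF t' y']] by (simp add: X_def)
    show "onorm (\<lambda>h. DU (t, y) (0, h)) \<le> B 1 + B 2 + B 3"
    proof (rule onorm_le)
      fix h
      have "norm (DU (t, y) (0, h)) \<le> norm h * B 1 + norm h * B 2 + norm h * B 3"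
        unfolding DU_space_expand[OF t' y', of h]
        using B[OF t y] component_le_norm_cart[of h]
        by (intro norm_triangle_le add_mono) (auto intro!: mult_mono)
      then show "norm (DU (t, y) (0, h)) \<le> (B 1 + B 2 + B 3) * norm h"
        by (simp add: algebra_simps)
    qed
  qed (use x in simp)
  then show ?thesis
    by (intro that[of "B 1 + B 2 + B 3"]) (auto simp: X_def)
qed

text \<open>The trajectory is bounded on \<open>{0..t}\<close> by continuity, which selects the ball
  for the Lipschitz constant. Gronwall for the squared distance from the stagnation point then
  forces it to remain zero.\<close>

lemma flow_fixes_origin:
  assumes origin: "\<And>t. t \<in> {0..<T} \<Longrightarrow> U t 0 = 0"
    and flow: "is_flow T U \<eta>" and t: "t \<in> {0..<T}"
  shows "\<eta> t 0 = 0"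
proof -
  have start: "\<eta> 0 0 = 0"
    and traj: "\<And>s. s \<in> {0..<T} \<Longrightarrow> \<eta> s 0 \<in> cylinder"
      "\<And>s. s \<in> {0..<T} \<Longrightarrow> ((\<lambda>s. \<eta> s 0) has_vector_derivative U s (\<eta> s 0)) (at s within {0..<T})"
    using flow zero_in_cylinder by (auto simp: is_flow_def)
  have sub: "{0..t} \<subseteq> {0..<T}"
    using t by auto
  have der: "((\<lambda>s. \<eta> s 0) has_vector_derivative U s (\<eta> s 0)) (at s within {0..t})" if "s \<in> {0..t}" for s
    using that sub by (intro has_vector_derivative_within_subset[OF traj(2)]) auto
  then have "continuous_on {0..t} (\<lambda>s. \<eta> s 0)"
    by (rule continuous_on_vector_derivative)
  then have "bounded ((\<lambda>s. \<eta> s 0) ` {0..t})"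
    by (intro compact_imp_bounded compact_continuous_image) auto
  then obtain R where R: "\<And>s. s \<in> {0..t} \<Longrightarrow> norm (\<eta> s 0) \<le> R"
    unfolding bounded_iff by blast
  obtain L where L: "\<And>s x. s \<in> {0..t} \<Longrightarrow> x \<in> cylinder \<Longrightarrow> norm x \<le> R \<Longrightarrow> norm (U s x - U s 0) \<le> L * norm x"
    using U_lipschitz[of t R] t by auto
  have "\<eta> t 0 \<bullet> \<eta> t 0 \<le> 0"
  proof (rule gronwall_nonpos[where h = "\<lambda>s. \<eta> s 0 \<bullet> \<eta> s 0" and h' = "\<lambda>s. 2 * (\<eta> s 0 \<bullet> U s (\<eta> s 0))" and K = "2 * L" and \<tau> = t])
    fix s assume s: "s \<in> {0..t}"
    show "((\<lambda>s. \<eta> s 0 \<bullet> \<eta> s 0) has_real_derivative 2 * (\<eta> s 0 \<bullet> U s (\<eta> s 0))) (at s within {0..t})"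
      by (intro deriv_inner_self der s)
    have "s \<in> {0..<T}"
      using s sub by blast
    have "\<eta> s 0 \<bullet> U s (\<eta> s 0) \<le> norm (\<eta> s 0) * norm (U s (\<eta> s 0))"
      by (rule norm_cauchy_schwarz)
    also have "\<dots> \<le> norm (\<eta> s 0) * (L * norm (\<eta> s 0))"
      using L[OF s traj(1)[OF \<open>s \<in> {0..<T}\<close>] R[OF s]] origin[OF \<open>s \<in> {0..<T}\<close>]
      by (intro mult_left_mono) auto
    finally show "2 * (\<eta> s 0 \<bullet> U s (\<eta> s 0)) \<le> 2 * L * (\<eta> s 0 \<bullet> \<eta> s 0)"
      by (simp add: dot_square_norm power2_eq_square algebra_simps)
  qed (use start t in auto)
  then show ?thesis
    by (metis inner_ge_zero inner_eq_zero_iff order_antisym)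
qed

section \<open>The velocity gradient at the origin and its evolution\<close>

definition "\<alpha> t = DU (t, 0) (0, axis 1 1) $ 1"
definition "\<beta> t = DU (t, 0) (0, axis 1 1) $ 2"

text \<open>All rays from the origin carry the same profiles, so the directional derivative has the
  same coefficients in each rotated frame.\<close>

lemma DU_origin_rotate:
  assumes "t \<in> {0..<T}"
  shows "DU (t, 0) (0, e_r \<theta>) = \<alpha> t *\<^sub>R e_r \<theta> + \<beta> t *\<^sub>R e_theta \<theta> + DU (t, 0) (0, axis 1 1) $ 3 *\<^sub>R e_z"
proof (rule vector_derivative_unique_within)
  have "((\<lambda>r. U t (cyl r \<theta> 0)) has_vector_derivative DU (t, cyl 0 \<theta> 0) (0, e_r \<theta>)) (at 0 within {0..1})" for \<theta>
    using U_deriv_r[OF assms, of 0] by simp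
  note der = this[unfolded cyl_0_eq_0]
  show "((\<lambda>r. U t (cyl r \<theta> 0)) has_vector_derivative DU (t, 0) (0, e_r \<theta>)) (at 0 within {0..1})"
    by (rule der)
  have comp: "((\<lambda>r. U t (cyl r 0 0) $ i) has_real_derivative DU (t, 0) (0, axis 1 1) $ i) (at 0 within {0..1})" for i
    using deriv_nth[OF der[of 0]] by (simp add: e_at_0)
  have scaled: "((\<lambda>r. U t (cyl r 0 0) $ i *\<^sub>R v) has_vector_derivative DU (t, 0) (0, axis 1 1) $ i *\<^sub>R v) (at 0 within {0..1})" for i v
    using has_vector_derivative_scaleR[OF comp has_vector_derivative_const, of i v] by simp
  have "((\<lambda>r. U t (cyl r 0 0) $ 1 *\<^sub>R e_r \<theta> + U t (cyl r 0 0) $ 2 *\<^sub>R e_theta \<theta> + U t (cyl r 0 0) $ 3 *\<^sub>R e_z)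
      has_vector_derivative DU (t, 0) (0, axis 1 1) $ 1 *\<^sub>R e_r \<theta> + DU (t, 0) (0, axis 1 1) $ 2 *\<^sub>R e_theta \<theta>
        + DU (t, 0) (0, axis 1 1) $ 3 *\<^sub>R e_z) (at 0 within {0..1})"
    by (intro has_vector_derivative_add scaled)
  then show "((\<lambda>r. U t (cyl r \<theta> 0)) has_vector_derivative
      \<alpha> t *\<^sub>R e_r \<theta> + \<beta> t *\<^sub>R e_theta \<theta> + DU (t, 0) (0, axis 1 1) $ 3 *\<^sub>R e_z) (at 0 within {0..1})"
    unfolding \<alpha>_def \<beta>_def
    by (rule has_vector_derivative_transform[of 0, rotated 2]) (auto simp: profile[OF assms])
qed (simp add: trivial_limit_within islimpt_Icc)

text \<open>Opposite rays share the slope of c but give derivatives of opposite sign, so that slope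
  is zero. The ray at a right angle gives the second column, and vanishing of the horizontal
  velocity on the axis gives the horizontal entries of the third.\<close>

lemma DU_origin:
  assumes t: "t \<in> {0..<T}"
  shows "DU (t, 0) (0, axis 1 1) = vector [\<alpha> t, \<beta> t, 0]"
    and "DU (t, 0) (0, axis 2 1) = vector [- \<beta> t, \<alpha> t, 0]"
    and "DU (t, 0) (0, axis 3 1) $ 1 = 0" "DU (t, 0) (0, axis 3 1) $ 2 = 0"
proof -
  have "e_r pi = - axis 1 1" "e_r (pi / 2) = axis 2 1" "e_theta (pi / 2) = - axis 1 1"
    by (simp_all add: vec_eq_iff forall_3)
  note angles = this
  have "DU (t, 0) (0, - axis 1 1) = - DU (t, 0) (0, axis 1 1)"
    by (rule linear_neg[OF has_derivative_linear[OF U_deriv_x[OF t zero_in_cylinder]]])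
  then have z: "DU (t, 0) (0, axis 1 1) $ 3 = 0"
    using arg_cong[OF DU_origin_rotate[OF t, of pi], of "\<lambda>y. y $ 3"] by (simp add: angles)
  then show "DU (t, 0) (0, axis 1 1) = vector [\<alpha> t, \<beta> t, 0]"
    by (simp add: vec_eq_iff forall_3 \<alpha>_def \<beta>_def)
  show "DU (t, 0) (0, axis 2 1) = vector [- \<beta> t, \<alpha> t, 0]"
    using DU_origin_rotate[OF t, of "pi / 2"] z by (simp add: angles vec_eq_iff forall_3)
  have "((\<lambda>z. U t (cyl 0 0 z)) has_vector_derivative DU (t, cyl 0 0 0) (0, e_z)) (at 0)"
    using U_deriv_z[OF t, of 0] by simp
  note der = deriv_nth[OF this, unfolded cyl_0_eq_0 e_at_0(3)]
  show "DU (t, 0) (0, axis 3 1) $ 1 = 0" "DU (t, 0) (0, axis 3 1) $ 2 = 0"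
    using der[of 1] der[of 2] DERIV_unique[OF _ DERIV_const] by (simp_all add: U_axis[OF t]) blast+
qed

lemma norm_vorticity_origin:
  assumes "t \<in> {0..<T}"
  shows "norm (curl (U t) 0) = 2 * \<bar>\<beta> t\<bar>"
proof -
  have "curl (U t) 0 = (2 * \<beta> t) *\<^sub>R axis 3 1"
    using DU_origin[OF assms]
    by (simp add: curl_def Let_def jac_eq[OF assms zero_in_cylinder] vec_eq_iff forall_3)
  then show ?thesis
    by (simp add: norm_axis_1)
qed

text \<open>The momentum equation is differentiated along a radius. Since U vanishes at the origin,
  the product rule leaves no second space derivatives of U. The horizontal block of the gradient
  acts as multiplication by \<alpha> + i \<beta>, so the quadratic term is its square.\<close>

lemma origin_ode:
  assumes origin: "U t 0 = 0" and t: "t \<in> {0..<T}"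
  shows "(\<alpha> has_real_derivative (\<beta> t)\<^sup>2 - (\<alpha> t)\<^sup>2 - d_rr (p t) 0 0) (at t within {0..<T})"
    and "(\<beta> has_real_derivative - 2 * \<alpha> t * \<beta> t) (at t within {0..<T})"
proof -
  let ?x = "\<lambda>s. cyl s 0 0"
  let ?d = "D2U (0, axis 1 1) (t, 0) (1, 0)"
  have x0: "?x 0 = 0"
    by (rule cyl_0_eq_0)
  have dt: "((\<lambda>s. DU (t, ?x s) (1, 0)) has_vector_derivative ?d) (at 0 within {0..1})"
    using DU_deriv_r[OF Basis_spacetime(1) t, of 0 0 0] by (simp add: x0 e_at_0 D2U_origin_commute[OF t])
  have dU: "((\<lambda>s. U t (?x s) $ i) has_real_derivative DU (t, 0) (0, axis 1 1) $ i) (at 0 within {0..1})" for i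
    using deriv_nth[OF U_deriv_r[OF t, of 0 0 0]] by (simp add: x0 e_at_0)
  have adv: "((\<lambda>s. U t (?x s) $ i *\<^sub>R DU (t, ?x s) (0, axis i 1)) has_vector_derivative
      DU (t, 0) (0, axis 1 1) $ i *\<^sub>R DU (t, 0) (0, axis i 1)) (at 0 within {0..1})" for i
    using has_vector_derivative_scaleR[OF dU[of i] DU_deriv_r[OF Basis_spacetime(2) t, of 0 0 0]]
    by (simp add: x0 origin)
  have "((\<lambda>s. - grad (P t) (?x s)) has_vector_derivative
      ?d + DU (t, 0) (0, axis 1 1) $ 1 *\<^sub>R DU (t, 0) (0, axis 1 1)
      + DU (t, 0) (0, axis 1 1) $ 2 *\<^sub>R DU (t, 0) (0, axis 2 1)
      + DU (t, 0) (0, axis 1 1) $ 3 *\<^sub>R DU (t, 0) (0, axis 3 1)) (at 0 within {0..1})"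
    by (rule has_vector_derivative_transform[OF _ _ has_vector_derivative_add[OF
          has_vector_derivative_add[OF has_vector_derivative_add[OF dt adv] adv] adv]])
      (simp_all add: momentum[OF t cyl_in_cylinder])
  then have grad: "((\<lambda>s. - grad (P t) (?x s)) has_vector_derivative
      ?d + \<alpha> t *\<^sub>R vector [\<alpha> t, \<beta> t, 0] + \<beta> t *\<^sub>R vector [- \<beta> t, \<alpha> t, 0]) (at 0 within {0..1})"
    by (simp add: DU_origin[OF t])
  have nontrivial: "at 0 within {0..1 :: real} \<noteq> bot"
    by (simp add: trivial_limit_within islimpt_Icc)
  have d1: "?d $ 1 = (\<beta> t)\<^sup>2 - (\<alpha> t)\<^sup>2 - d_rr (p t) 0 0"
  proof -
    have "((\<lambda>s. - (grad (P t) (?x s) $ 1)) has_vector_derivative ?d $ 1 + (\<alpha> t)\<^sup>2 - (\<beta> t)\<^sup>2) (at 0 within {0..1})"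
      using deriv_nth[OF grad, of 1]
      by (simp add: has_real_derivative_iff_has_vector_derivative power2_eq_square)
    then have "?d $ 1 + (\<alpha> t)\<^sup>2 - (\<beta> t)\<^sup>2 = - d_rr (p t) 0 0"
      using vector_derivative_unique_within[OF nontrivial] has_vector_derivative_minus[OF d_rr_pressure[OF t]] by blast
    then show ?thesis by simp
  qed
  have d2: "?d $ 2 = - 2 * \<alpha> t * \<beta> t"
  proof -
    have "((\<lambda>s. - (grad (P t) (?x s) $ 2)) has_vector_derivative ?d $ 2 + 2 * \<alpha> t * \<beta> t) (at 0 within {0..1})"
      using deriv_nth[OF grad, of 2]
      by (simp add: has_real_derivative_iff_has_vector_derivative mult_ac add_ac)
    then have "?d $ 2 + 2 * \<alpha> t * \<beta> t = - 0"
      using vector_derivative_unique_within[OF nontrivial] has_vector_derivative_minus[OF grad_origin_2[OF t]] by blast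
    then show ?thesis by simp
  qed
  have "((\<lambda>t. DU (t, 0) (0, axis 1 1)) has_vector_derivative ?d) (at t within {0..<T})"
    by (intro DU_deriv_t Basis_spacetime t zero_in_cylinder)
  from deriv_nth[OF this, of 1] deriv_nth[OF this, of 2]
  show "(\<alpha> has_real_derivative (\<beta> t)\<^sup>2 - (\<alpha> t)\<^sup>2 - d_rr (p t) 0 0) (at t within {0..<T})"
    and "(\<beta> has_real_derivative - 2 * \<alpha> t * \<beta> t) (at t within {0..<T})"
    unfolding d1 d2 by (simp_all add: \<alpha>_def[abs_def] \<beta>_def[abs_def])
qed

text \<open>A limsup strictly below 1/4 gives the pointwise bound from some time on, where the
  oscillation argument applies; before that time \<beta> is bounded by compactness.\<close>

lemma vorticity_integral_finite:
  assumes origin: "\<And>t. t \<in> {0..<T} \<Longrightarrow> U t 0 = 0"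
    and less: "Limsup (at_left T) (\<lambda>t. ereal ((T - t)\<^sup>2 * d_rr (p t) 0 0)) < ereal (1 / 4)"
  shows "(\<integral>\<^sup>+ t\<in>{0..<T}. ennreal (norm (curl (U t) 0)) \<partial>lborel) < \<infinity>"
proof -
  have "eventually (\<lambda>t. ereal ((T - t)\<^sup>2 * d_rr (p t) 0 0) < ereal (1 / 4)) (at_left T)"
    using less by (rule Limsup_lessD)
  then obtain s where s: "s < T" "\<And>t. s < t \<Longrightarrow> t < T \<Longrightarrow> (T - t)\<^sup>2 * d_rr (p t) 0 0 < 1 / 4"
    by (auto simp: eventually_at_left_field)
  \<comment> \<open>The midpoint of \<open>s\<close> and \<open>T\<close> lies strictly between
    them, and \<open>T / 2\<close> keeps the starting time positive.\<close>
  define t0 where "t0 = max (T / 2) ((s + T) / 2)"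
  have t0: "0 < t0" "s < t0" "t0 < T"
    using s T_pos by (auto simp: t0_def less_max_iff_disj)
  have sub: "{t0..<T} \<subseteq> {0..<T}"
    using t0 by auto
  interpret ode: axis_ode t0 T \<alpha> \<beta> "\<lambda>t. d_rr (p t) 0 0"
  proof
    fix t assume t: "t \<in> {t0..<T}"
    then have t': "t \<in> {0..<T}"
      using sub by blast
    show "(\<alpha> has_real_derivative (\<beta> t)\<^sup>2 - (\<alpha> t)\<^sup>2 - d_rr (p t) 0 0) (at t within {t0..<T})"
      "(\<beta> has_real_derivative - 2 * \<alpha> t * \<beta> t) (at t within {t0..<T})"
      by (rule DERIV_subset[OF origin_ode(1)[OF origin[OF t'] t'] sub]
          DERIV_subset[OF origin_ode(2)[OF origin[OF t'] t'] sub])+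
    show "(T - t)\<^sup>2 * d_rr (p t) 0 0 < 1 / 4"
      using s(2)[of t] t t0 by auto
  qed (use t0 in simp)
  have cont: "continuous_on {0..<T} \<beta>"
    using origin_ode(2)[OF origin] by (rule DERIV_continuous_on)
  have "{0..t0} \<subseteq> {0..<T}"
    using t0 by auto
  then have "bounded (\<beta> ` {0..t0})"
    by (intro compact_imp_bounded compact_continuous_image continuous_on_subset[OF cont]) auto
  then obtain B where B: "\<And>t. t \<in> {0..t0} \<Longrightarrow> \<bar>\<beta> t\<bar> \<le> B"
    unfolding bounded_iff real_norm_def by blast
  have meas: "(\<lambda>t. ennreal \<bar>\<beta> t\<bar> * indicator {t0..<T} t) \<in> borel_measurable borel"
  proof -
    have "(\<lambda>t. indicator {t0..<T} t *\<^sub>R \<bar>\<beta> t\<bar>) \<in> borel_measurable borel"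
      by (intro borel_measurable_continuous_on_indicator continuous_intros continuous_on_subset[OF cont sub]) auto
    then have "(\<lambda>t. ennreal (indicator {t0..<T} t * \<bar>\<beta> t\<bar>)) \<in> borel_measurable borel"
      by simp
    moreover have "(\<lambda>t. ennreal (indicator {t0..<T} t * \<bar>\<beta> t\<bar>)) = (\<lambda>t. ennreal \<bar>\<beta> t\<bar> * indicator {t0..<T} t)"
      by (auto simp: indicator_def fun_eq_iff)
    ultimately show ?thesis by (simp only:)
  qed
  \<comment> \<open>The factor 2 comes from the vorticity being twice \<beta> at the origin. The two
    indicators overlap at \<open>t0\<close>, which is harmless in an upper bound.\<close>
  have "(\<integral>\<^sup>+ t\<in>{0..<T}. ennreal (norm (curl (U t) 0)) \<partial>lborel)
      \<le> (\<integral>\<^sup>+ t. 2 * (ennreal B * indicator {0..t0} t + ennreal \<bar>\<beta> t\<bar> * indicator {t0..<T} t) \<partial>lborel)"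
  proof (rule nn_integral_mono)
    fix t
    consider "t \<in> {0..<t0}" | "t \<in> {t0..<T}" | "t \<notin> {0..<T}"
      using t0 by fastforce
    then show "ennreal (norm (curl (U t) 0)) * indicator {0..<T} t
        \<le> 2 * (ennreal B * indicator {0..t0} t + ennreal \<bar>\<beta> t\<bar> * indicator {t0..<T} t)"
    proof cases
      case 1
      then have "ennreal (norm (curl (U t) 0)) \<le> 2 * ennreal B"
        using B[of t] t0 by (auto simp: norm_vorticity_origin ennreal_mult' intro!: mult_left_mono ennreal_leI)
      then show ?thesis
        using 1 t0 by (simp add: indicator_def)
    next
      case 2
      then have "ennreal (norm (curl (U t) 0)) = 2 * ennreal \<bar>\<beta> t\<bar>"
        using t0 by (auto simp: norm_vorticity_origin ennreal_mult')
      then show ?thesis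
        using 2 t0 by (auto simp: indicator_def intro!: mult_left_mono)
    next
      case 3
      then show ?thesis by simp
    qed
  qed
  also have "\<dots> = 2 * ((\<integral>\<^sup>+ t. ennreal B * indicator {0..t0} t \<partial>lborel)
      + (\<integral>\<^sup>+ t\<in>{t0..<T}. ennreal \<bar>\<beta> t\<bar> \<partial>lborel))"
    using meas by (simp add: nn_integral_cmult nn_integral_add)
  also have "\<dots> < \<infinity>"
    using ode.integral_finite t0
    by (simp add: nn_integral_cmult_indicator ennreal_mult_less_top ennreal_add_less_top)
  finally show ?thesis .
qed

end

theorem theorem1p1:
  fixes T :: real
    and a b c p :: "real \<Rightarrow> real \<Rightarrow> real \<Rightarrow> real"
    and U :: "real \<Rightarrow> real^3 \<Rightarrow> real^3" and P :: "real \<Rightarrow> real^3 \<Rightarrow> real"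
    and U\<^sub>0 :: "real^3 \<Rightarrow> real^3" and a\<^sub>0 b\<^sub>0 c\<^sub>0 :: "real \<Rightarrow> real \<Rightarrow> real"
  assumes "0 < T"
    and "axisymmetric_euler_solution T a b c p U P U\<^sub>0"
    and "axisymmetric_field a\<^sub>0 b\<^sub>0 c\<^sub>0 U\<^sub>0"
    and "odd_in_z c\<^sub>0" and "even_in_z a\<^sub>0" and "even_in_z b\<^sub>0"
  shows "(\<forall>\<eta>. is_flow T U \<eta> \<longrightarrow> (\<forall>t\<in>{0..<T}. \<eta> t 0 = 0)) \<and>
         ((\<integral>\<^sup>+ t\<in>{0..<T}. ennreal (norm (curl (U t) 0)) \<partial>lborel) = \<infinity> \<longrightarrow>
          Limsup (at_left T) (\<lambda>t. ereal ((T - t)\<^sup>2 * d_rr (p t) 0 0)) \<ge> ereal (1 / 4))"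
proof -
  interpret euler_flow T a b c p U P U\<^sub>0
    using assms by unfold_locales
  have origin: "U t 0 = 0" if "t \<in> {0..<T}" for t
    using U_origin[OF assms(3-6) that] .
  show ?thesis
  proof (intro conjI impI allI ballI)
    show "\<eta> t 0 = 0" if "is_flow T U \<eta>" "t \<in> {0..<T}" for \<eta> t
      using flow_fixes_origin[OF origin that] .
    show "Limsup (at_left T) (\<lambda>t. ereal ((T - t)\<^sup>2 * d_rr (p t) 0 0)) \<ge> ereal (1 / 4)"
      if "(\<integral>\<^sup>+ t\<in>{0..<T}. ennreal (norm (curl (U t) 0)) \<partial>lborel) = \<infinity>"
      using vorticity_integral_finite[OF origin] that by (rule_tac ccontr) (simp add: not_le)
  qed
qed

end
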